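(* Let $S$ be a Polish space, $B>0$, and let $(X_1,Y_1),\dots,(X_n,Y_n)$ be a sequence of independent (not necessarily identically distributed) random elements of $S\times\mathbb{R}$. Let $\mathcal{G}$ be a family of Borel measurable functions $S\to\mathbb{R}$ with $|g(x)|\le B$ for all $(g,x)\in\mathcal{G}\times S$, for which there exist $$\hat g\in\arg\min_{g\in\mathcal{G}}\sum_{k=1}^n|g(X_k)-T_BY_k|^2,\qquad\tilde g\in\arg\min_{g\in\mathcal{G}}\sum_{k=1}^n\mathrm{E}\big[|g(X_k)-T_BY_k|^2\big].$$ For $1\le k\le n$ let $\phi_k:S\to[-B,B]$ be a Borel function with $\phi_k(X_k)=\mathrm{E}[T_BY_k\mid X_k]$ almost surely, and let $\|\cdot\|_k$ be the $L^2$ norm associated to the law of $X_k$. Then for every $(c,\lambda,\delta)\in(1,\infty)\times(1,\infty)\times(0,1)$, the inequality $$\frac1n\sum_{k=1}^n\|\hat g-\phi_k\|_k^2\le(6\lambda-5)\inf_{g\in\mathcal{G}}\frac1n\sum_{k=1}^n\|g-\phi_k\|_k^2+6\max\left\{\epsilon_n(c,\lambda),\ \frac1{n\,b(c,\lambda)}\Big(\log a(c,\lambda,\epsilon_n(c,\lambda))+\log(2/\delta)\Big)\right\}$$ holds with probability at least $1-\delta$, where $a$, $b$, $\epsilon_n$ are the functions defined in the context.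
   Context: $T_By=\min\{\max\{y,-B\},B\}$ is the truncation operator, and $T_B\mathcal{G}=\{T_Bg:g\in\mathcal{G}\}$, where $(T_Bg)(x)=T_B(g(x))$. The function $\hat g$ depends on the sample; in $\|\hat g-\phi_k\|_k^2=\int|\hat g(x)-\phi_k(x)|^2\,\mathrm{P}_{X_k}(dx)$ the function $\hat g$ is held fixed, so this is a random quantity. Covering numbers: for $x_{1:n}\in S^n$, a family $\mathcal{F}$ of Borel functions $S\to\mathbb{R}$ and $r\ge0$, $\mathcal{N}_1(\mathcal{F},x_{1:n},r)$ is the smallest $m\in\mathbb{N}$ such that there is a set $\mathcal{L}_0$ of $m$ elements $l_{1:n}=(l_1,\dots,l_n)$, with each $l_k:S\to\mathbb{R}$ Borel, such that for every $f\in\mathcal{F}$ there is $l_{1:n}\in\mathcal{L}_0$ with $\frac1n\sum_{k=1}^n|l_k(x_k)-f(x_k)|\le r$ (and $\infty$ if there is none). For $c,\lambda>1$ and $\epsilon>0$ define $$A(x_{1:n},c,\lambda,\epsilon)=2(c+1)(2c+3)\,\mathcal{N}_1\left(T_B\mathcal{G},x_{1:n},\frac1{2^5}\frac1B\frac1{\lambda(c-1)+1}\Big(1-\frac1c\Big)\epsilon\right),\qquad a(c,\lambda,\epsilon)=\mathrm{E}[A(X_{1:n},c,\lambda,\epsilon)],$$ $$\epsilon_n(c,\lambda)=8B^2\left(-(\lambda-1)+\sqrt{(\lambda-1)^2+c(c+1)\lambda^2/n}\right),$$ $$b(c,\lambda)=\frac1{2^5B^2}\,\frac1{\left(\frac13(1-\frac1c)(1-\frac1\lambda)+(2\lambda-1)\right)^2}\Big(1-\frac1c\Big)^3\Big(1-\frac1\lambda\Big).$$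 Standing assumption: families of functions are nonempty and pointwise measurable, i.e. there is a countable subfamily of $\mathcal{G}$ such that every element of $\mathcal{G}$ is the pointwise limit of a sequence from that subfamily. *)

theory Defs
  imports "HOL-Probability.Probability" "HOL-Library.Extended_Nat"
begin

definition trunc :: "real \<Rightarrow> real \<Rightarrow> real" where
  "trunc B y = min (max y (- B)) B"

definition trunc_family :: "real \<Rightarrow> ('a \<Rightarrow> real) set \<Rightarrow> ('a \<Rightarrow> real) set" where
  "trunc_family B G = (\<lambda>g x. trunc B (g x)) ` G"

definition pointwise_measurable :: "('a \<Rightarrow> real) set \<Rightarrow> bool" where
  "pointwise_measurable G \<longleftrightarrow>
     (\<exists>G0 \<subseteq> G. countable G0 \<and>
        (\<forall>g \<in> G. \<exists>h :: nat \<Rightarrow> 'a \<Rightarrow> real. (\<forall>i. h i \<in> G0) \<and> (\<forall>x. (\<lambda>i. h i x) \<longlonglongrightarrow> g x)))"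

definition L2_norm :: "'a measure \<Rightarrow> ('a \<Rightarrow> real) \<Rightarrow> real" where
  "L2_norm \<mu> f = sqrt (LINT x|\<mu>. \<bar>f x\<bar>\<^sup>2)"

(* The extensional function space represents the tuples indexed by 1..n, so that
   card counts tuples.  The infimum of the empty set in enat is infinity. *)
definition covering_number ::
  "('a::topological_space \<Rightarrow> real) set \<Rightarrow> nat \<Rightarrow> (nat \<Rightarrow> 'a) \<Rightarrow> real \<Rightarrow> enat" where
  "covering_number F n x r =
     Inf {enat m | m. \<exists>L0 \<subseteq> {1..n} \<rightarrow>\<^sub>E borel_measurable borel. finite L0 \<and> card L0 = m \<and>
       (\<forall>f \<in> F. \<exists>l \<in> L0. 1 / real n * (\<Sum>k=1..n. \<bar>l k (x k) - f (x k)\<bar>) \<le> r)}"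

definition A_cov ::
  "real \<Rightarrow> ('a::topological_space \<Rightarrow> real) set \<Rightarrow> nat \<Rightarrow> (nat \<Rightarrow> 'a) \<Rightarrow> real \<Rightarrow> real \<Rightarrow> real \<Rightarrow> ennreal" where
  "A_cov B G n x c lam \<epsilon> =
     ennreal (2 * (c + 1) * (2 * c + 3)) *
     ennreal_of_enat (covering_number (trunc_family B G) n x
       (1 / 2 ^ 5 * (1 / B) * (1 / (lam * (c - 1) + 1)) * (1 - 1 / c) * \<epsilon>))"

definition a_cov ::
  "'w measure \<Rightarrow> (nat \<Rightarrow> 'w \<Rightarrow> 'a::topological_space) \<Rightarrow> real \<Rightarrow> ('a \<Rightarrow> real) set \<Rightarrow> nat \<Rightarrow>
     real \<Rightarrow> real \<Rightarrow> real \<Rightarrow> ennreal" where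
  "a_cov M X B G n c lam \<epsilon> = (\<integral>\<^sup>+ \<omega>. A_cov B G n (\<lambda>k. X k \<omega>) c lam \<epsilon> \<partial>M)"

definition eps_n :: "real \<Rightarrow> nat \<Rightarrow> real \<Rightarrow> real \<Rightarrow> real" where
  "eps_n B n c lam =
     8 * B\<^sup>2 * (- (lam - 1) + sqrt ((lam - 1)\<^sup>2 + c * (c + 1) * lam\<^sup>2 / real n))"

definition b_rate :: "real \<Rightarrow> real \<Rightarrow> real \<Rightarrow> real" where
  "b_rate B c lam =
     1 / (2 ^ 5 * B\<^sup>2) *
     (1 / (1 / 3 * (1 - 1 / c) * (1 - 1 / lam) + (2 * lam - 1))\<^sup>2) *
     (1 - 1 / c) ^ 3 * (1 - 1 / lam)"

definition log_ennreal :: "ennreal \<Rightarrow> ereal" where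
  "log_ennreal z =
     (if z = 0 then - \<infinity> else if z = \<infinity> then \<infinity> else ereal (ln (enn2real z)))"

end

theory Submission
  imports Defs
begin

text \<open>
  For \<open>g\<close> in the family let \<open>f\<^sub>k(g) = (g(X\<^sub>k) - T\<^sub>B Y\<^sub>k)\<^sup>2 - (\<phi>\<^sub>k(X\<^sub>k) - T\<^sub>B Y\<^sub>k)\<^sup>2\<close> be the excess loss and
  \<open>h\<^sub>k(g) = (g(X\<^sub>k) - \<phi>\<^sub>k(X\<^sub>k))\<^sup>2\<close>.  As \<open>\<phi>\<^sub>k(X\<^sub>k)\<close> is the conditional mean of \<open>T\<^sub>B Y\<^sub>k\<close>, the two have the same
  expectation, so \<open>gtilde\<close> attains the infimum in the bound, while \<open>ghat\<close> minimizes
  \<open>\<Sum>\<^sub>k f\<^sub>k\<close>.  Everything therefore reduces to a two-sided relative deviation inequality: with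
  probability at least \<open>1 - \<delta>\<close>, all \<open>g\<close> satisfy
  \<open>(1 - 2\<gamma>) \<Sum>\<^sub>k E h\<^sub>k(g) - s \<le> \<Sum>\<^sub>k f\<^sub>k(g) \<le> (1 + 2\<gamma>) \<Sum>\<^sub>k E h\<^sub>k(g) + s\<close>.
  The left part is used for \<open>ghat\<close> and the right part for \<open>gtilde\<close>.  With \<open>t\<close> the maximum in the bound,
  the choice \<open>\<gamma> = (\<lambda> - 1)/(2\<lambda> - 1)\<close>, \<open>s = 3nt/(2\<lambda> - 1)\<close> gives the factor \<open>4\<lambda> - 3 \<le> 6\<lambda> - 5\<close> and the
  remainder \<open>6t\<close>.

  Each half of the inequality says that \<open>\<Sum>\<^sub>k (E p\<^sub>k(g) + m\<^sub>k(g))\<close> stays below \<open>s\<close>, where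
  \<open>p = \<sigma> f - 2\<gamma> h\<close>, \<open>m = - \<sigma> f\<close> and \<open>\<sigma> = 1\<close> or \<open>\<sigma> = -1\<close>.  It follows from a bound on the exponential
  moment of the supremum over \<open>g\<close>, in three steps.

  Symmetrization (\<open>nn_integral_SUP_exp_symmetrization\<close>): convexity of \<open>exp\<close> replaces the term of one
  coordinate by the mean of two, one containing \<open>2 E p\<close> and one containing \<open>2 m\<close>, and Jensen's inequality
  turns \<open>2 E p\<close> into \<open>2 p\<close> at the observation itself.  Coordinate after coordinate this produces an average
  over all \<open>2\<^sup>n\<close> patterns of choices between \<open>p\<close> and \<open>m\<close>.  There is no second sample, which is why covering
  numbers on the \<open>n\<close> observed points are enough.

  Self-normalization (\<open>offset_excess_self_normalized\<close>): for a single function the average over patterns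
  is the product of the numbers \<open>(exp(2\<theta>p) + exp(2\<theta>m))/2\<close>, each equal to
  \<open>exp(-2\<theta>\<gamma>h) cosh(2\<theta>(\<sigma>f - \<gamma>h))\<close>.  Since \<open>(\<sigma>f - \<gamma>h)\<^sup>2 \<le> 16 B\<^sup>2 h\<close>, the offset \<open>\<gamma>h\<close> compensates the fluctuation
  as soon as \<open>16 B\<^sup>2 \<theta> \<le> \<gamma>\<close>, and the product is at most one.

  Covering (\<open>sum_signs_SUP_exp_le_covering_number\<close>): replacing \<open>g\<close> by the nearest element of a cover
  costs a factor \<open>exp(16 \<theta> B n r)\<close>, and the supremum becomes a sum over the cover.  Markov's inequality
  then gives \<open>uniform_offset_deviation\<close>, and \<open>exponent_le\<close> checks that the exponent is at least \<open>n b t\<close>.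
\<close>

section \<open>Symmetrization over independent coordinates\<close>

text \<open>
  Jensen's inequality for \<open>exp\<close> with values in the extended reals, so that \<open>exp \<circ> f\<close> may fail to be
  integrable; the expectation of the tangent of \<open>exp\<close> at the mean of \<open>f\<close> gives the bound.
\<close>

lemma (in prob_space) exp_expectation_le_nn_integral_exp:
  assumes f: "integrable M f"
  shows "ennreal (exp (expectation f)) \<le> (\<integral>\<^sup>+x. ennreal (exp (f x)) \<partial>M)"
proof -
  let ?c = "expectation f"
  have tangent: "exp ?c * (1 + (f x - ?c)) \<le> exp (f x)" for x
    using exp_ge_add_one_self[of "f x - ?c"] by (simp add: exp_diff field_simps)
  have "ennreal (exp ?c) = ennreal (\<integral>x. exp ?c * (1 + (f x - ?c)) \<partial>M)"
    using f by (simp add: prob_space algebra_simps)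
  also have "\<dots> \<le> (\<integral>\<^sup>+x. ennreal (exp ?c * (1 + (f x - ?c))) \<partial>M)"
  proof -
    let ?g = "\<lambda>x. exp ?c * (1 + (f x - ?c))"
    have g: "integrable M ?g" using f by simp
    then have "(\<integral>x. ?g x \<partial>M) \<le> (\<integral>x. max 0 (?g x) \<partial>M)" by (intro integral_mono integrable_max) auto
    then have "ennreal (\<integral>x. ?g x \<partial>M) \<le> ennreal (\<integral>x. max 0 (?g x) \<partial>M)" by (rule ennreal_leI)
    also have "\<dots> = (\<integral>\<^sup>+x. ennreal (max 0 (?g x)) \<partial>M)"
      using g by (intro nn_integral_eq_integral[symmetric] integrable_max) auto
    also have "\<dots> = (\<integral>\<^sup>+x. ennreal (?g x) \<partial>M)"
      by (intro nn_integral_cong) (simp add: max_def ennreal_neg)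
    finally show ?thesis .
  qed
  also have "\<dots> \<le> (\<integral>\<^sup>+x. ennreal (exp (f x)) \<partial>M)"
    by (intro nn_integral_mono ennreal_leI tangent)
  finally show ?thesis .
qed

lemma exp_add_le: "exp (x + y) \<le> (exp (2 * x) + exp (2 * y)) / 2" for x y :: real
proof -
  have "0 \<le> (exp x - exp y)\<^sup>2" by simp
  then show ?thesis by (simp add: power2_diff exp_double exp_add)
qed

text \<open>
  The treatment of one coordinate.  For each \<open>j\<close>, convexity separates the exponent into
  \<open>a j + 2 E p\<close> and \<open>a j + 2 m\<close>.  The supremum over \<open>j\<close> of the first part is below the expectation of the
  supremum, by Jensen's inequality for each \<open>j\<close>, so \<open>E p\<close> may be replaced by \<open>p\<close> under the integral.
\<close>

lemma (in prob_space) nn_integral_SUP_exp_one_step: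
  fixes p m :: "'j \<Rightarrow> 'a \<Rightarrow> real"
  assumes J: "countable J"
    and p: "\<And>j. j \<in> J \<Longrightarrow> integrable M (p j)"
    and m: "\<And>j. j \<in> J \<Longrightarrow> m j \<in> borel_measurable M"
  shows "(\<integral>\<^sup>+x. (SUP j\<in>J. ennreal (exp (a j + (expectation (p j) + m j x)))) \<partial>M)
    \<le> (\<integral>\<^sup>+x. ((SUP j\<in>J. ennreal (exp (a j + 2 * p j x)))
             + (SUP j\<in>J. ennreal (exp (a j + 2 * m j x)))) / 2 \<partial>M)"
proof -
  note [measurable] = m borel_measurable_integrable[OF p] and [simp] = J
  let ?P = "\<lambda>x. SUP j\<in>J. ennreal (exp (a j + 2 * p j x))"
  let ?Q = "\<lambda>x. SUP j\<in>J. ennreal (exp (a j + 2 * m j x))"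
  have "(SUP j\<in>J. ennreal (exp (a j + (expectation (p j) + m j x)))) \<le> ((\<integral>\<^sup>+x. ?P x \<partial>M) + ?Q x) / 2" for x
  proof (rule SUP_least)
    fix j assume j: "j \<in> J"
    have "exp (a j + (expectation (p j) + m j x)) \<le> (exp (a j + 2 * expectation (p j)) + exp (a j + 2 * m j x)) / 2"
      using exp_add_le[of "a j / 2 + expectation (p j)" "a j / 2 + m j x"] by (simp add: algebra_simps)
    then have "ennreal (exp (a j + (expectation (p j) + m j x))) \<le>
      ennreal ((exp (a j + 2 * expectation (p j)) + exp (a j + 2 * m j x)) / 2)"
      by (rule ennreal_leI)
    also have "\<dots> = (ennreal (exp (a j + 2 * expectation (p j))) + ennreal (exp (a j + 2 * m j x))) / 2"
      by (simp add: ennreal_plus[symmetric] ennreal_divide_numeral del: ennreal_plus)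
    also have "exp (a j + 2 * expectation (p j)) = exp (expectation (\<lambda>x. a j + 2 * p j x))"
      using p[OF j] by (simp add: prob_space)
    also have "ennreal \<dots> \<le> (\<integral>\<^sup>+x. ennreal (exp (a j + 2 * p j x)) \<partial>M)"
      using p[OF j] by (intro exp_expectation_le_nn_integral_exp) simp
    also have "\<dots> \<le> (\<integral>\<^sup>+x. ?P x \<partial>M)"
      by (intro nn_integral_mono SUP_upper j)
    also have "ennreal (exp (a j + 2 * m j x)) \<le> ?Q x" by (intro SUP_upper j)
    finally show "ennreal (exp (a j + (expectation (p j) + m j x))) \<le> ((\<integral>\<^sup>+x. ?P x \<partial>M) + ?Q x) / 2"
      by (simp add: divide_right_mono_ennreal add_mono)
  qed
  then have "(\<integral>\<^sup>+x. (SUP j\<in>J. ennreal (exp (a j + (expectation (p j) + m j x)))) \<partial>M)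
      \<le> (\<integral>\<^sup>+y. ((\<integral>\<^sup>+x. ?P x \<partial>M) + ?Q y) / 2 \<partial>M)"
    by (intro nn_integral_mono)
  also have "\<dots> = (\<integral>\<^sup>+x. (?P x + ?Q x) / 2 \<partial>M)"
    by (simp add: nn_integral_divide nn_integral_add emeasure_space_1)
  finally show ?thesis .
qed

lemma ennreal_half_of_divide_power2:
  fixes x y :: ennreal
  shows "(x / 2 ^ k + y / 2 ^ k) / 2 = (y + x) / 2 ^ Suc k"
proof -
  have "inverse (2 * 2 ^ k :: ennreal) = inverse 2 * inverse (2 ^ k)"
    by (intro ennreal_inverse_mult) (auto simp: power_less_top_ennreal)
  then show ?thesis by (simp add: divide_ennreal_def algebra_simps)
qed

lemma nn_integral_midpoint:
  assumes [measurable]: "f \<in> borel_measurable M" "g \<in> borel_measurable M"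
  shows "(\<integral>\<^sup>+x. (f x + g x) / 2 \<partial>M) = ((\<integral>\<^sup>+x. f x \<partial>M) + (\<integral>\<^sup>+x. g x \<partial>M)) / 2"
  by (simp add: nn_integral_divide nn_integral_add)

text \<open>
  Symmetrization of a supremum of exponential sums over independent coordinates.  A set \<open>U\<close> of
  coordinates plays the role of a pattern of random signs: \<open>p\<close> is used on \<open>U\<close> and \<open>m\<close> off \<open>U\<close>.
  The summand \<open>a j\<close> is present for the induction, in which it collects the coordinates already
  treated; it must be arbitrary there, as it then depends on the values of these coordinates.
\<close>

lemma (in product_prob_space) nn_integral_SUP_exp_symmetrization:
  fixes p m :: "'j \<Rightarrow> 'i \<Rightarrow> 'a \<Rightarrow> real" and a :: "'j \<Rightarrow> real"
  assumes "finite K" and J: "countable J"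
    and p: "\<And>j k. j \<in> J \<Longrightarrow> k \<in> K \<Longrightarrow> integrable (M k) (p j k)"
    and m: "\<And>j k. j \<in> J \<Longrightarrow> k \<in> K \<Longrightarrow> m j k \<in> borel_measurable (M k)"
  shows "(\<integral>\<^sup>+z. (SUP j\<in>J. ennreal (exp (a j + (\<Sum>k\<in>K. (\<integral>x. p j k x \<partial>M k) + m j k (z k))))) \<partial>Pi\<^sub>M K M)
    \<le> (\<integral>\<^sup>+z. (\<Sum>U\<in>Pow K. SUP j\<in>J. ennreal (exp (a j +
            2 * (\<Sum>k\<in>K. if k \<in> U then p j k (z k) else m j k (z k))))) / 2 ^ card K \<partial>Pi\<^sub>M K M)"
  using assms(1) p m
proof (induction K arbitrary: a)
  case empty
  then show ?case by (simp add: divide_ennreal_def)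
next
  case (insert i K)
  note fin = insert.hyps(1) and i = insert.hyps(2)
  have p': "\<And>j k. j \<in> J \<Longrightarrow> k \<in> K \<Longrightarrow> integrable (M k) (p j k)"
    and m': "\<And>j k. j \<in> J \<Longrightarrow> k \<in> K \<Longrightarrow> m j k \<in> borel_measurable (M k)"
    using insert.prems by auto
  note [measurable] = insert.prems(2) borel_measurable_integrable[OF insert.prems(1)]
  note [simp] = J
  let ?E = "\<lambda>j z. a j + (\<Sum>k\<in>K. (\<integral>x. p j k x \<partial>M k) + m j k (z k))"
  let ?H = "\<lambda>z. ((SUP j\<in>J. ennreal (exp (?E j z + 2 * p j i (z i))))
             + (SUP j\<in>J. ennreal (exp (?E j z + 2 * m j i (z i))))) / 2"
  let ?R = "\<lambda>b z. (\<Sum>U\<in>Pow K. SUP j\<in>J. ennreal (exp (b j +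
            2 * (\<Sum>k\<in>K. if k \<in> U then p j k (z k) else m j k (z k))))) / 2 ^ card K"
  let ?L = "\<lambda>b z. SUP j\<in>J. ennreal (exp (b j + (\<Sum>k\<in>K. (\<integral>x. p j k x \<partial>M k) + m j k (z k))))"
  have L: "?L b \<in> borel_measurable (Pi\<^sub>M K M)" and R: "?R b \<in> borel_measurable (Pi\<^sub>M K M)" for b
    by measurable
  have upd: "(\<Sum>k\<in>K. (\<integral>x. p j k x \<partial>M k) + m j k ((z(i := y)) k)) = (\<Sum>k\<in>K. (\<integral>x. p j k x \<partial>M k) + m j k (z k))" for j z y
    using i by (intro sum.cong) auto
  have H: "?H \<in> borel_measurable (Pi\<^sub>M (insert i K) M)" by measurable
  have "(\<integral>\<^sup>+z. (SUP j\<in>J. ennreal (exp (a j + (\<Sum>k\<in>insert i K. (\<integral>x. p j k x \<partial>M k) + m j k (z k))))) \<partial>Pi\<^sub>M (insert i K) M)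
     = (\<integral>\<^sup>+z. (\<integral>\<^sup>+y. (SUP j\<in>J. ennreal (exp (?E j z + ((\<integral>x. p j i x \<partial>M i) + m j i y)))) \<partial>M i) \<partial>Pi\<^sub>M K M)"
  proof -
    let ?F = "\<lambda>z. SUP j\<in>J. ennreal (exp (a j + (\<Sum>k\<in>insert i K. (\<integral>x. p j k x \<partial>M k) + m j k (z k))))"
    have F: "?F \<in> borel_measurable (Pi\<^sub>M (insert i K) M)" by measurable
    have eq: "a j + (\<Sum>k\<in>insert i K. (\<integral>x. p j k x \<partial>M k) + m j k ((z(i := y)) k)) = ?E j z + ((\<integral>x. p j i x \<partial>M i) + m j i y)" for j z y
      using fin i upd[of j z y] by (simp add: fun_upd_same del: fun_upd_apply)
    show ?thesis unfolding product_nn_integral_insert[OF fin i F] eq ..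
  qed
  also have "\<dots> \<le> (\<integral>\<^sup>+z. (\<integral>\<^sup>+y. ?H (z(i := y)) \<partial>M i) \<partial>Pi\<^sub>M K M)"
    unfolding upd fun_upd_same
    by (intro nn_integral_mono M.nn_integral_SUP_exp_one_step) (auto intro: insert.prems)
  \<comment> \<open>The integrals are exchanged, so that the induction hypothesis applies with coordinate \<open>i\<close> frozen.\<close>
  also have "\<dots> = integral\<^sup>N (Pi\<^sub>M (insert i K) M) ?H"
    by (rule product_nn_integral_insert[OF fin i H, symmetric])
  also have "\<dots> = (\<integral>\<^sup>+y. (\<integral>\<^sup>+z. ?H (z(i := y)) \<partial>Pi\<^sub>M K M) \<partial>M i)"
    by (rule product_nn_integral_insert_rev[OF fin i H])
  also have "\<dots> \<le> (\<integral>\<^sup>+y. (\<integral>\<^sup>+z. (?R (\<lambda>j. a j + 2 * p j i y) z + ?R (\<lambda>j. a j + 2 * m j i y) z) / 2 \<partial>Pi\<^sub>M K M) \<partial>M i)"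
  proof (rule nn_integral_mono)
    fix y
    have "(\<integral>\<^sup>+z. ?H (z(i := y)) \<partial>Pi\<^sub>M K M) = (\<integral>\<^sup>+z. (?L (\<lambda>j. a j + 2 * p j i y) z + ?L (\<lambda>j. a j + 2 * m j i y) z) / 2 \<partial>Pi\<^sub>M K M)"
      unfolding upd fun_upd_same by (simp add: algebra_simps)
    also have "\<dots> = ((\<integral>\<^sup>+z. ?L (\<lambda>j. a j + 2 * p j i y) z \<partial>Pi\<^sub>M K M)
        + (\<integral>\<^sup>+z. ?L (\<lambda>j. a j + 2 * m j i y) z \<partial>Pi\<^sub>M K M)) / 2"
      by (rule nn_integral_midpoint; rule L)
    also have "\<dots> \<le> ((\<integral>\<^sup>+z. ?R (\<lambda>j. a j + 2 * p j i y) z \<partial>Pi\<^sub>M K M) + (\<integral>\<^sup>+z. ?R (\<lambda>j. a j + 2 * m j i y) z \<partial>Pi\<^sub>M K M)) / 2"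
      by (intro divide_right_mono_ennreal add_mono insert.IH p' m')
    also have "\<dots> = (\<integral>\<^sup>+z. (?R (\<lambda>j. a j + 2 * p j i y) z + ?R (\<lambda>j. a j + 2 * m j i y) z) / 2 \<partial>Pi\<^sub>M K M)"
      by (rule nn_integral_midpoint[symmetric]; rule R)
    finally show "(\<integral>\<^sup>+z. ?H (z(i := y)) \<partial>Pi\<^sub>M K M) \<le>
      (\<integral>\<^sup>+z. (?R (\<lambda>j. a j + 2 * p j i y) z + ?R (\<lambda>j. a j + 2 * m j i y) z) / 2 \<partial>Pi\<^sub>M K M)" .
  qed
  also have "\<dots> = (\<integral>\<^sup>+y. (\<integral>\<^sup>+z. (\<Sum>U\<in>Pow (insert i K). SUP j\<in>J. ennreal (exp (a j +
            2 * (\<Sum>k\<in>insert i K. if k \<in> U then p j k ((z(i := y)) k) else m j k ((z(i := y)) k))))) / 2 ^ card (insert i K) \<partial>Pi\<^sub>M K M) \<partial>M i)"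
  proof (intro nn_integral_cong)
    fix y z
    let ?S = "\<lambda>U. SUP j\<in>J. ennreal (exp (a j +
            2 * (\<Sum>k\<in>insert i K. if k \<in> U then p j k ((z(i := y)) k) else m j k ((z(i := y)) k))))"
    have S0: "?S U = (SUP j\<in>J. ennreal (exp (a j + 2 * m j i y +
            2 * (\<Sum>k\<in>K. if k \<in> U then p j k (z k) else m j k (z k)))))" if "U \<in> Pow K" for U
    proof (intro SUP_cong refl arg_cong[where f=ennreal] arg_cong[where f=exp])
      fix j
      have "(\<Sum>k\<in>K. if k \<in> U then p j k ((z(i := y)) k) else m j k ((z(i := y)) k)) = (\<Sum>k\<in>K. if k \<in> U then p j k (z k) else m j k (z k))"
        using i by (intro sum.cong) auto
      moreover have "i \<notin> U" using i that by auto
      ultimately show "a j + 2 * (\<Sum>k\<in>insert i K. if k \<in> U then p j k ((z(i := y)) k) else m j k ((z(i := y)) k)) = a j + 2 * m j i y +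
            2 * (\<Sum>k\<in>K. if k \<in> U then p j k (z k) else m j k (z k))" 
        using fin i by (simp add: algebra_simps)
    qed
    have S1: "?S (insert i U) = (SUP j\<in>J. ennreal (exp (a j + 2 * p j i y +
            2 * (\<Sum>k\<in>K. if k \<in> U then p j k (z k) else m j k (z k)))))" if "U \<in> Pow K" for U
    proof (intro SUP_cong refl arg_cong[where f=ennreal] arg_cong[where f=exp])
      fix j
      have "(\<Sum>k\<in>K. if k \<in> insert i U then p j k ((z(i := y)) k) else m j k ((z(i := y)) k)) = (\<Sum>k\<in>K. if k \<in> U then p j k (z k) else m j k (z k))"
        using i by (intro sum.cong) auto
      then show "a j + 2 * (\<Sum>k\<in>insert i K. if k \<in> insert i U then p j k ((z(i := y)) k) else m j k ((z(i := y)) k)) = a j + 2 * p j i y +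
            2 * (\<Sum>k\<in>K. if k \<in> U then p j k (z k) else m j k (z k))" 
        using fin i by (simp add: algebra_simps)
    qed
    have "inj_on (insert i) (Pow K)" using i by (auto simp: inj_on_def)
    then have "sum ?S (Pow (insert i K)) = sum ?S (Pow K) + (\<Sum>U\<in>Pow K. ?S (insert i U))"
      unfolding Pow_insert using fin i by (subst sum.union_disjoint) (auto simp: sum.reindex)
    also have "\<dots> = (\<Sum>U\<in>Pow K. SUP j\<in>J. ennreal (exp (a j + 2 * m j i y +
            2 * (\<Sum>k\<in>K. if k \<in> U then p j k (z k) else m j k (z k))))) + 
         (\<Sum>U\<in>Pow K. SUP j\<in>J. ennreal (exp (a j + 2 * p j i y +
            2 * (\<Sum>k\<in>K. if k \<in> U then p j k (z k) else m j k (z k)))))"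
      by (intro arg_cong2[where f="(+)"] sum.cong refl S0 S1)
    finally show "(?R (\<lambda>j. a j + 2 * p j i y) z + ?R (\<lambda>j. a j + 2 * m j i y) z) / 2 = sum ?S (Pow (insert i K)) / 2 ^ card (insert i K)"
      using fin i
      by (simp only: ennreal_half_of_divide_power2 card_insert_disjoint[OF fin i])
  qed
  also have "\<dots> = (\<integral>\<^sup>+z. (\<Sum>U\<in>Pow (insert i K). SUP j\<in>J. ennreal (exp (a j +
            2 * (\<Sum>k\<in>insert i K. if k \<in> U then p j k (z k) else m j k (z k))))) / 2 ^ card (insert i K) \<partial>Pi\<^sub>M (insert i K) M)"
    by (rule product_nn_integral_insert_rev[OF fin i, symmetric]) measurable
  finally show ?case .
qed

section \<open>The offset excess loss\<close>

text \<open>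
  Hoeffding's lemma for a fair sign, read off from his bound on the logarithm of
  \<open>(1 + exp (2x)) / 2 = exp x * cosh x\<close>.
\<close>

lemma cosh_le_exp_square_half: "cosh x \<le> exp (x\<^sup>2 / 2)" for x :: real
proof -
  have pos: "cosh x \<le> exp (x\<^sup>2 / 2)" if "0 < x" for x :: real
  proof -
    have "- (2 * x) * (1/2) + ln (1 + 1/2 * (exp (2 * x) - 1)) \<le> (2 * x)\<^sup>2 / 8"
      using Hoeffdings_lemma_aux[of "2 * x" "1/2"] that by (simp add: algebra_simps)
    moreover have "1 + 1/2 * (exp (2 * x) - 1) = exp x * cosh x"
      by (simp add: cosh_def field_simps flip: exp_add)
    ultimately have "ln (cosh x) \<le> x\<^sup>2 / 2"
      by (simp add: ln_mult power2_eq_square)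
    then show ?thesis by (metis cosh_real_pos exp_le_cancel_iff exp_ln)
  qed
  show ?thesis using pos[of x] pos[of "-x"] by (cases "x = 0") (auto, metis linorder_neqE_linordered_idom)
qed

text \<open>
  Here \<open>a\<close>, \<open>w\<close>, \<open>y\<close> stand for the values of \<open>g\<close>, of the regression function and of the truncated
  response at one observation.  The signs \<open>\<sigma> = 1\<close> and \<open>\<sigma> = -1\<close> serve the lower and the upper half of
  the relative deviation inequality; the subtracted square is the offset that absorbs fluctuations.
\<close>

definition offset_excess :: "real \<Rightarrow> real \<Rightarrow> real \<Rightarrow> real \<Rightarrow> real \<Rightarrow> real" where
  "offset_excess \<sigma> \<gamma> w y a = \<sigma> * ((a - y)\<^sup>2 - (w - y)\<^sup>2) - 2 * \<gamma> * (a - w)\<^sup>2"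

lemma offset_excess_lipschitz:
  assumes "\<bar>\<sigma>\<bar> \<le> 1" "0 \<le> \<gamma>" "\<gamma> \<le> 1/2"
    and "\<bar>w\<bar> \<le> B" "\<bar>y\<bar> \<le> B" "\<bar>a\<bar> \<le> B" "\<bar>a'\<bar> \<le> B"
  shows "\<bar>offset_excess \<sigma> \<gamma> w y a - offset_excess \<sigma> \<gamma> w y a'\<bar> \<le> 8 * B * \<bar>a - a'\<bar>"
proof -
  have "\<bar>\<sigma> * (a + a' - 2 * y)\<bar> \<le> 1 * (4 * B)"
    unfolding abs_mult using assms by (intro mult_mono) auto
  moreover have "\<bar>2 * \<gamma> * (a + a' - 2 * w)\<bar> \<le> 1 * (4 * B)"
    unfolding abs_mult[of "2 * \<gamma>"] using assms by (intro mult_mono) auto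
  ultimately have "\<bar>\<sigma> * (a + a' - 2 * y) - 2 * \<gamma> * (a + a' - 2 * w)\<bar> \<le> 8 * B"
    by linarith
  moreover have "offset_excess \<sigma> \<gamma> w y a - offset_excess \<sigma> \<gamma> w y a'
      = (\<sigma> * (a + a' - 2 * y) - 2 * \<gamma> * (a + a' - 2 * w)) * (a - a')"
    unfolding offset_excess_def by (simp add: power2_eq_square algebra_simps)
  ultimately show ?thesis
    by (simp add: abs_mult mult_right_mono)
qed

text \<open>
  With \<open>v = \<sigma> f - \<gamma> h\<close> the two exponents are \<open>2\<theta>(v - \<gamma> h)\<close> and \<open>2\<theta>(- v - \<gamma> h)\<close>.  The difference of
  squares in \<open>f\<close> has the factor \<open>a - w\<close>, hence \<open>v\<^sup>2 \<le> 16 B\<^sup>2 h\<close>, and \<open>cosh x \<le> exp (x\<^sup>2 / 2)\<close> shows that the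
  factor \<open>exp (- 2\<theta>\<gamma> h)\<close> outweighs the hyperbolic cosine.
\<close>

lemma offset_excess_self_normalized:
  assumes "\<bar>\<sigma>\<bar> \<le> 1" "0 \<le> \<gamma>" "\<gamma> \<le> 1/2" "0 \<le> \<theta>" "16 * B\<^sup>2 * \<theta> \<le> \<gamma>"
    and "\<bar>w\<bar> \<le> B" "\<bar>y\<bar> \<le> B" "\<bar>a\<bar> \<le> B"
  shows "exp (2 * (\<theta> * offset_excess \<sigma> \<gamma> w y a)) + exp (2 * (\<theta> * offset_excess (- \<sigma>) 0 w y a)) \<le> 2"
proof -
  define v where "v = \<sigma> * ((a - y)\<^sup>2 - (w - y)\<^sup>2) - \<gamma> * (a - w)\<^sup>2"
  have "\<bar>\<sigma> * (a + w - 2 * y) - \<gamma> * (a - w)\<bar> \<le> 4 * B"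
  proof -
    have "\<bar>(\<sigma> - \<gamma>) * a\<bar> \<le> \<bar>\<sigma> - \<gamma>\<bar> * B" "\<bar>(\<sigma> + \<gamma>) * w\<bar> \<le> \<bar>\<sigma> + \<gamma>\<bar> * B" "\<bar>2 * \<sigma> * y\<bar> \<le> \<bar>2 * \<sigma>\<bar> * B"
      unfolding abs_mult using assms by (intro mult_mono; simp)+
    moreover have "(\<bar>\<sigma> - \<gamma>\<bar> + \<bar>\<sigma> + \<gamma>\<bar> + \<bar>2 * \<sigma>\<bar>) * B \<le> 4 * B"
      using assms by (intro mult_right_mono) auto
    moreover have "\<sigma> * (a + w - 2 * y) - \<gamma> * (a - w) = (\<sigma> - \<gamma>) * a + (\<sigma> + \<gamma>) * w - 2 * \<sigma> * y"
      by (simp add: algebra_simps)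
    ultimately show ?thesis unfolding distrib_right by linarith
  qed
  moreover have "v = (\<sigma> * (a + w - 2 * y) - \<gamma> * (a - w)) * (a - w)"
    unfolding v_def by (simp add: power2_eq_square algebra_simps)
  ultimately have "\<bar>v\<bar> \<le> 4 * B * \<bar>a - w\<bar>"
    by (simp add: abs_mult mult_right_mono)
  then have v2: "v\<^sup>2 \<le> 16 * B\<^sup>2 * (a - w)\<^sup>2"
    using power_mono[of "\<bar>v\<bar>" "4 * B * \<bar>a - w\<bar>" 2] by (simp add: power_mult_distrib)
  have "(2 * \<theta> * v)\<^sup>2 / 2 = 2 * \<theta> * (\<theta> * v\<^sup>2)" by (simp add: power2_eq_square)
  also have "\<dots> \<le> 2 * \<theta> * (\<theta> * (16 * B\<^sup>2 * (a - w)\<^sup>2))"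
    using v2 assms by (intro mult_left_mono) auto
  also have "\<dots> \<le> 2 * \<theta> * (\<gamma> * (a - w)\<^sup>2)"
    using mult_right_mono[OF assms(5), of "(a - w)\<^sup>2"] assms(4)
    by (intro mult_left_mono) (auto simp: algebra_simps)
  finally have "cosh (2 * \<theta> * v) \<le> exp (2 * \<theta> * (\<gamma> * (a - w)\<^sup>2))"
    using cosh_le_exp_square_half[of "2 * \<theta> * v"] by (meson exp_le_cancel_iff order_trans)
  moreover have "exp (2 * (\<theta> * offset_excess \<sigma> \<gamma> w y a)) + exp (2 * (\<theta> * offset_excess (- \<sigma>) 0 w y a))
      = 2 * (cosh (2 * \<theta> * v) * exp (- (2 * \<theta> * (\<gamma> * (a - w)\<^sup>2))))"
    unfolding offset_excess_def v_def cosh_def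
    by (simp add: algebra_simps flip: exp_add)
  ultimately show ?thesis
    using mult_right_mono[of "cosh (2 * \<theta> * v)" "exp (2 * \<theta> * (\<gamma> * (a - w)\<^sup>2))" "exp (- (2 * \<theta> * (\<gamma> * (a - w)\<^sup>2)))"]
    by (simp flip: exp_add)
qed

lemma abs_trunc_le: "0 \<le> B \<Longrightarrow> \<bar>trunc B y\<bar> \<le> B"
  by (auto simp: trunc_def)

lemma trunc_id: "\<bar>y\<bar> \<le> B \<Longrightarrow> trunc B y = y"
  by (auto simp: trunc_def)

lemma trunc_nonexpansive: "\<bar>trunc B y - trunc B y'\<bar> \<le> \<bar>y - y'\<bar>"
  by (auto simp: trunc_def min_def max_def)

section \<open>Covering numbers and averages over patterns\<close>

lemma covering_number_attained:
  assumes "covering_number F n x r \<noteq> \<infinity>"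
  obtains L0 where "L0 \<subseteq> {1..n} \<rightarrow>\<^sub>E borel_measurable borel" "finite L0"
    "covering_number F n x r = enat (card L0)"
    "\<And>f. f \<in> F \<Longrightarrow> \<exists>l\<in>L0. 1 / real n * (\<Sum>k=1..n. \<bar>l k (x k) - f (x k)\<bar>) \<le> r"
proof -
  let ?S = "{enat m | m. \<exists>L0 \<subseteq> {1..n} \<rightarrow>\<^sub>E borel_measurable borel. finite L0 \<and> card L0 = m \<and>
       (\<forall>f \<in> F. \<exists>l \<in> L0. 1 / real n * (\<Sum>k=1..n. \<bar>l k (x k) - f (x k)\<bar>) \<le> r)}"
  have "?S \<noteq> {}" using assms unfolding covering_number_def by (metis Inf_empty top_enat_def)
  then have "Inf ?S \<in> ?S" by (metis (no_types, lifting) Inf_enat_def LeastI ex_in_conv)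
  then have "covering_number F n x r \<in> ?S" unfolding covering_number_def .
  then obtain m L0 where "covering_number F n x r = enat m"
    "L0 \<subseteq> {1..n} \<rightarrow>\<^sub>E borel_measurable borel" "finite L0" "card L0 = m"
    "\<forall>f \<in> F. \<exists>l \<in> L0. 1 / real n * (\<Sum>k=1..n. \<bar>l k (x k) - f (x k)\<bar>) \<le> r"
    by (elim CollectE exE conjE) blast
  then show ?thesis using that[of L0] by auto
qed

text \<open>
  The pointwise counterpart of symmetrization.  The cover depends on the points \<open>x k\<close> but not on the
  pattern \<open>U\<close>, so the sum over \<open>U\<close> can be taken for each element of the cover separately, where it
  factorizes over the coordinates.  Truncating the elements of the cover keeps them within the range
  in which the Lipschitz bound holds and does not increase distances to \<open>G\<close>.
\<close>

lemma sum_signs_SUP_exp_le_covering_number: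
  assumes B: "0 \<le> B" and G0: "G0 \<subseteq> G" and G: "\<And>g x. g \<in> G \<Longrightarrow> \<bar>g x\<bar> \<le> B"
    and w: "\<And>k. k \<in> {1..n} \<Longrightarrow> \<bar>w k\<bar> \<le> B" and y: "\<And>k. k \<in> {1..n} \<Longrightarrow> \<bar>y k\<bar> \<le> B"
    and par: "\<bar>\<sigma>\<bar> \<le> 1" "0 \<le> \<gamma>" "\<gamma> \<le> 1/2" "0 \<le> \<theta>" "16 * B\<^sup>2 * \<theta> \<le> \<gamma>" and n: "n \<ge> 1"
  shows "(\<Sum>U\<in>Pow {1..n}. SUP g\<in>G0. ennreal (exp (2 * (\<Sum>k\<in>{1..n}. if k \<in> U
            then \<theta> * offset_excess \<sigma> \<gamma> (w k) (y k) (g (x k))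
            else \<theta> * offset_excess (- \<sigma>) 0 (w k) (y k) (g (x k)))))) / 2 ^ card {1..n}
      \<le> ennreal (exp (16 * \<theta> * B * real n * r)) * ennreal_of_enat (covering_number (trunc_family B G) n x r)"
proof (cases "covering_number (trunc_family B G) n x r = \<infinity>")
  case True
  then show ?thesis by (simp add: ennreal_mult_top)
next
  case False
  let ?e = "exp (16 * \<theta> * B * real n * r)"
  let ?up = "\<lambda>k a. \<theta> * offset_excess \<sigma> \<gamma> (w k) (y k) a"
  let ?down = "\<lambda>k a. \<theta> * offset_excess (- \<sigma>) 0 (w k) (y k) a"
  let ?ex = "\<lambda>U v. exp (2 * (\<Sum>k\<in>{1..n}. if k \<in> U then ?up k (v k) else ?down k (v k)))"
  obtain L0 where "L0 \<subseteq> {1..n} \<rightarrow>\<^sub>E borel_measurable borel"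
    and L0: "finite L0" "covering_number (trunc_family B G) n x r = enat (card L0)"
    and cover: "\<And>f. f \<in> trunc_family B G \<Longrightarrow> \<exists>l\<in>L0. 1 / real n * (\<Sum>k=1..n. \<bar>l k (x k) - f (x k)\<bar>) \<le> r"
    by (rule covering_number_attained[OF False]) (rule that)
  define v where "v l k = trunc B (l k (x k))" for l :: "nat \<Rightarrow> 'a \<Rightarrow> real" and k
  have sup: "(SUP g\<in>G0. ennreal (?ex U (\<lambda>k. g (x k)))) \<le> ennreal (?e * (\<Sum>l\<in>L0. ?ex U (v l)))" for U
  proof (intro SUP_least ennreal_leI)
    fix g assume g: "g \<in> G0"
    then have gG: "g \<in> G" using G0 by auto
    then have "g \<in> trunc_family B G"
      unfolding trunc_family_def using G by (intro image_eqI[of _ _ g]) (auto simp: trunc_id)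
    from cover[OF this] obtain l where l: "l \<in> L0" "1 / real n * (\<Sum>k=1..n. \<bar>l k (x k) - g (x k)\<bar>) \<le> r" by blast
    have "(\<Sum>k=1..n. \<bar>g (x k) - v l k\<bar>) \<le> (\<Sum>k=1..n. \<bar>l k (x k) - g (x k)\<bar>)"
      unfolding v_def using trunc_nonexpansive[of B "g (x _)" "l _ (x _)"] G[OF gG]
      by (intro sum_mono) (simp add: trunc_id abs_minus_commute)
    also have "\<dots> \<le> real n * r" using l n by (simp add: field_simps)
    finally have dist: "(\<Sum>k=1..n. \<bar>g (x k) - v l k\<bar>) \<le> real n * r" .
    have "(\<Sum>k\<in>{1..n}. if k \<in> U then ?up k (g (x k)) else ?down k (g (x k)))
        \<le> (\<Sum>k\<in>{1..n}. (if k \<in> U then ?up k (v l k) else ?down k (v l k)) + \<theta> * (8 * B * \<bar>g (x k) - v l k\<bar>))"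
    proof (intro sum_mono)
      fix k assume k: "k \<in> {1..n}"
      have "\<bar>offset_excess s c (w k) (y k) (g (x k)) - offset_excess s c (w k) (y k) (v l k)\<bar> \<le> 8 * B * \<bar>g (x k) - v l k\<bar>"
        if "\<bar>s\<bar> \<le> 1" "0 \<le> c" "c \<le> 1/2" for s c
        using that w[OF k] y[OF k] G[OF gG] abs_trunc_le[OF B]
        by (intro offset_excess_lipschitz) (auto simp: v_def)
      from this[of \<sigma> \<gamma>] this[of "-\<sigma>" 0] par have
        "offset_excess \<sigma> \<gamma> (w k) (y k) (g (x k)) \<le> offset_excess \<sigma> \<gamma> (w k) (y k) (v l k) + 8 * B * \<bar>g (x k) - v l k\<bar>"
        "offset_excess (-\<sigma>) 0 (w k) (y k) (g (x k)) \<le> offset_excess (-\<sigma>) 0 (w k) (y k) (v l k) + 8 * B * \<bar>g (x k) - v l k\<bar>"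
        by auto
      from this[THEN mult_left_mono, OF par(4)]
      show "(if k \<in> U then ?up k (g (x k)) else ?down k (g (x k)))
        \<le> (if k \<in> U then ?up k (v l k) else ?down k (v l k)) + \<theta> * (8 * B * \<bar>g (x k) - v l k\<bar>)"
        by (simp add: distrib_left)
    qed
    also have "\<dots> = (\<Sum>k\<in>{1..n}. if k \<in> U then ?up k (v l k) else ?down k (v l k)) + 8 * \<theta> * B * (\<Sum>k=1..n. \<bar>g (x k) - v l k\<bar>)"
      by (simp add: sum.distrib sum_distrib_left mult_ac)
    also have "8 * \<theta> * B * (\<Sum>k=1..n. \<bar>g (x k) - v l k\<bar>) \<le> 8 * \<theta> * B * (real n * r)"
      using B par by (intro mult_left_mono dist) auto
    finally have "?ex U (\<lambda>k. g (x k)) \<le> ?e * ?ex U (v l)"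
      by (simp flip: exp_add add: algebra_simps)
    also have "?ex U (v l) \<le> (\<Sum>l\<in>L0. ?ex U (v l))"
      using l L0 by (intro member_le_sum) auto
    finally show "?ex U (\<lambda>k. g (x k)) \<le> ?e * (\<Sum>l\<in>L0. ?ex U (v l))" by simp
  qed
  have avg: "(\<Sum>U\<in>Pow {1..n}. ?ex U (v l)) \<le> 2 ^ n" for l
  proof -
    have "?ex U (v l) = (\<Prod>k\<in>U. exp (2 * ?up k (v l k))) * (\<Prod>k\<in>{1..n}-U. exp (2 * ?down k (v l k)))" 
      if "U \<in> Pow {1..n}" for U
    proof -
      have "{1..n} \<inter> U = U" using that by auto
      then have "(\<Sum>k\<in>{1..n}. if k \<in> U then ?up k (v l k) else ?down k (v l k)) =
        (\<Sum>k\<in>U. ?up k (v l k)) + (\<Sum>k\<in>{1..n}-U. ?down k (v l k))"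
        by (subst sum.If_cases) (auto simp: Diff_eq)
      moreover have "finite U" using that finite_subset by auto
      ultimately show ?thesis by (simp add: exp_add exp_sum sum_distrib_left distrib_left)
    qed
    then have "(\<Sum>U\<in>Pow {1..n}. ?ex U (v l)) = (\<Prod>k\<in>{1..n}. exp (2 * ?up k (v l k)) + exp (2 * ?down k (v l k)))"
      by (simp add: prod_add)
    also have "\<dots> \<le> (\<Prod>k\<in>{1..n}. 2)"
      using w y par abs_trunc_le[OF B]
      by (intro prod_mono conjI offset_excess_self_normalized[where B=B]) (auto simp: v_def add_nonneg_nonneg)
    finally show ?thesis by simp
  qed
  have "(\<Sum>U\<in>Pow {1..n}. SUP g\<in>G0. ennreal (?ex U (\<lambda>k. g (x k))))
      \<le> (\<Sum>U\<in>Pow {1..n}. ennreal (?e * (\<Sum>l\<in>L0. ?ex U (v l))))"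
    by (intro sum_mono sup)
  also have "\<dots> = ennreal (?e * (\<Sum>l\<in>L0. \<Sum>U\<in>Pow {1..n}. ?ex U (v l)))"
    by (subst sum_ennreal) (auto intro!: mult_nonneg_nonneg sum_nonneg simp: sum_distrib_left sum.swap[of _ L0])
  also have "\<dots> \<le> ennreal (?e * (\<Sum>l\<in>L0. 2 ^ n))"
    by (intro ennreal_leI mult_left_mono sum_mono avg) auto
  finally have "(\<Sum>U\<in>Pow {1..n}. SUP g\<in>G0. ennreal (?ex U (\<lambda>k. g (x k)))) / 2 ^ n
     \<le> ennreal (?e * (\<Sum>l\<in>L0. 2 ^ n)) / 2 ^ n"
    by (rule divide_right_mono_ennreal)
  also have "\<dots> = ennreal (?e * (\<Sum>l\<in>L0. 2 ^ n)) / ennreal (2 ^ n)"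
    by (simp flip: ennreal_power)
  also have "\<dots> = ennreal (?e * card L0)"
    by (subst divide_ennreal) auto
  also have "\<dots> = ennreal ?e * of_nat (card L0)"
    by (simp add: ennreal_mult'' flip: ennreal_of_nat_eq_real_of_nat)
  finally show ?thesis using L0 by simp
qed

section \<open>Uniform deviation of the offset excess loss\<close>

lemma borel_measurable_trunc [measurable]: "trunc B \<in> borel_measurable borel"
  unfolding trunc_def by measurable

lemma abs_offset_excess_le:
  assumes "\<bar>\<sigma>\<bar> \<le> 1" "0 \<le> \<gamma>" "\<gamma> \<le> 1/2" "\<bar>w\<bar> \<le> B" "\<bar>y\<bar> \<le> B" "\<bar>a\<bar> \<le> B"
  shows "\<bar>offset_excess \<sigma> \<gamma> w y a\<bar> \<le> 16 * B\<^sup>2"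
proof -
  have "\<bar>offset_excess \<sigma> \<gamma> w y a\<bar> \<le> 8 * B * \<bar>a - w\<bar>"
    using offset_excess_lipschitz[OF assms assms(4)] by (simp add: offset_excess_def)
  also have "\<dots> \<le> 8 * B * (2 * B)" using assms by (intro mult_left_mono) auto
  finally show ?thesis by (simp add: power2_eq_square)
qed

text \<open>
  Chernoff bound for the supremum over a countable subfamily; countability makes the event and
  the supremum measurable, while the cover may be that of the whole family.
\<close>

lemma (in prob_space) uniform_offset_deviation:
  fixes X :: "nat \<Rightarrow> 'a \<Rightarrow> 'b::second_countable_topology" and Y :: "nat \<Rightarrow> 'a \<Rightarrow> real"
  assumes indep: "indep_vars (\<lambda>k. borel :: ('b \<times> real) measure) (\<lambda>k \<omega>. (X k \<omega>, Y k \<omega>)) {1..n}"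
    and n: "n \<ge> 1" and B: "0 \<le> B"
    and G0: "G0 \<subseteq> G" "countable G0"
    and Gm: "\<And>g. g \<in> G \<Longrightarrow> g \<in> borel_measurable borel" and Gb: "\<And>g x. g \<in> G \<Longrightarrow> \<bar>g x\<bar> \<le> B"
    and \<phi>m: "\<And>k. k \<in> {1..n} \<Longrightarrow> \<phi> k \<in> borel_measurable borel"
    and \<phi>b: "\<And>k x. k \<in> {1..n} \<Longrightarrow> \<bar>\<phi> k x\<bar> \<le> B"
    and par: "\<bar>\<sigma>\<bar> \<le> 1" "0 \<le> \<gamma>" "\<gamma> \<le> 1/2" "0 \<le> \<theta>" "16 * B\<^sup>2 * \<theta> \<le> \<gamma>"
  defines "dev g \<omega> \<equiv> \<Sum>k\<in>{1..n}.
             expectation (\<lambda>\<omega>. offset_excess \<sigma> \<gamma> (\<phi> k (X k \<omega>)) (trunc B (Y k \<omega>)) (g (X k \<omega>)))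
             + offset_excess (- \<sigma>) 0 (\<phi> k (X k \<omega>)) (trunc B (Y k \<omega>)) (g (X k \<omega>))"
  shows "{\<omega> \<in> space M. \<exists>g\<in>G0. s < dev g \<omega>} \<in> events"
    and "emeasure M {\<omega> \<in> space M. \<exists>g\<in>G0. s < dev g \<omega>}
      \<le> ennreal (exp (16 * \<theta> * B * real n * r - \<theta> * s))
         * (\<integral>\<^sup>+\<omega>. ennreal_of_enat (covering_number (trunc_family B G) n (\<lambda>k. X k \<omega>) r) \<partial>M)"
proof -
  note [measurable (raw)] = borel_measurable_continuous_onI[OF continuous_on_fst[OF continuous_on_id]]
    borel_measurable_continuous_onI[OF continuous_on_snd[OF continuous_on_id]]
  note [simp] = G0(2)
  let ?I = "{1..n}"
  define Z where "Z k \<omega> = (X k \<omega>, Y k \<omega>)" for k \<omega>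
  have Z [measurable]: "Z k \<in> M \<rightarrow>\<^sub>M borel" if "k \<in> ?I" for k
    using indep that unfolding indep_vars_def Z_def by auto
  have law0: "distr M (Pi\<^sub>M ?I (\<lambda>_. borel)) (\<lambda>\<omega>. \<lambda>k\<in>?I. Z k \<omega>) = Pi\<^sub>M ?I (\<lambda>k. distr M borel (Z k))"
  proof -
    have "indep_vars (\<lambda>_. borel) Z ?I" using indep by (simp add: Z_def[abs_def])
    then show ?thesis
      using indep_vars_iff_distr_eq_PiM'[of ?I Z "\<lambda>_. borel"] Z n by auto
  qed
  \<comment> \<open>Outside \<open>{1..n}\<close> the maps \<open>Z k\<close> are arbitrary, but a product of measures needs probability spaces at all indices.\<close>
  define \<mu> where "\<mu> k = (if k \<in> ?I then distr M borel (Z k) else return borel undefined)" for k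
  have sets_\<mu> [measurable_cong]: "sets (\<mu> k) = sets borel" for k by (simp add: \<mu>_def)
  have prob_\<mu>: "prob_space (\<mu> k)" for k
    by (auto simp: \<mu>_def intro: prob_space_distr prob_space_return)
  interpret \<mu>: product_prob_space \<mu>
    by (intro product_prob_spaceI prob_\<mu>)
  define p where "p g k z = \<theta> * offset_excess \<sigma> \<gamma> (\<phi> k (fst z)) (trunc B (snd z)) (g (fst z))" for g k and z :: "'b \<times> real"
  define m where "m g k z = \<theta> * offset_excess (- \<sigma>) 0 (\<phi> k (fst z)) (trunc B (snd z)) (g (fst z))" for g k and z :: "'b \<times> real"
  have pm [measurable]: "p g k \<in> borel_measurable borel" and mm [measurable]: "m g k \<in> borel_measurable borel"
    if "g \<in> G0" "k \<in> ?I" for g k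
  proof -
    have [measurable]: "g \<in> borel_measurable borel" "\<phi> k \<in> borel_measurable borel" using that G0 Gm \<phi>m by auto
    show "p g k \<in> borel_measurable borel" "m g k \<in> borel_measurable borel"
      unfolding p_def m_def offset_excess_def by measurable
  qed
  have pint: "integrable (\<mu> k) (p g k)" if "g \<in> G0" "k \<in> ?I" for g k
  proof -
    have fin: "finite_measure (\<mu> k)" using prob_\<mu> by (rule prob_space.finite_measure)
    have "norm (p g k z) \<le> \<theta> * (16 * B\<^sup>2)" for z
      using that par Gb G0 \<phi>b abs_trunc_le[OF B] unfolding p_def
      by (auto simp: abs_mult intro!: mult_left_mono abs_offset_excess_le)
    then show ?thesis
      using pm[OF that] by (intro finite_measure.integrable_const_bound[OF fin, where B="\<theta> * (16 * B\<^sup>2)"]) (auto cong: measurable_cong_sets)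
  qed
  have law: "Pi\<^sub>M ?I \<mu> = distr M (Pi\<^sub>M ?I (\<lambda>_. borel)) (\<lambda>\<omega>. \<lambda>k\<in>?I. Z k \<omega>)"
  proof -
    have "Pi\<^sub>M ?I \<mu> = Pi\<^sub>M ?I (\<lambda>k. distr M borel (Z k))" by (intro PiM_cong) (auto simp: \<mu>_def)
    then show ?thesis using law0 by simp
  qed
  have Zv: "(\<lambda>\<omega>. \<lambda>k\<in>?I. Z k \<omega>) \<in> M \<rightarrow>\<^sub>M Pi\<^sub>M ?I (\<lambda>_. borel)"
    by (intro measurable_restrict Z)
  define F where "F z = (SUP g\<in>G0. ennreal (exp ((\<Sum>k\<in>?I. (\<integral>x. p g k x \<partial>\<mu> k) + m g k (z k)))))" for z
  define R where "R z = (\<Sum>U\<in>Pow ?I. SUP g\<in>G0. ennreal (exp (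
            2 * (\<Sum>k\<in>?I. if k \<in> U then p g k (z k) else m g k (z k))))) / 2 ^ card ?I" for z
  have Fm: "F \<in> borel_measurable (Pi\<^sub>M ?I (\<lambda>_. borel))" and Rm: "R \<in> borel_measurable (Pi\<^sub>M ?I (\<lambda>_. borel))"
    unfolding F_def R_def by measurable
  let ?N = "\<lambda>\<omega>. ennreal_of_enat (covering_number (trunc_family B G) n (\<lambda>k. X k \<omega>) r)"
  let ?e = "exp (16 * \<theta> * B * real n * r)"
  let ?FZ = "\<lambda>\<omega>. F (\<lambda>k\<in>?I. Z k \<omega>)"
  have FZ [measurable]: "?FZ \<in> borel_measurable M" by (rule measurable_compose[OF Zv Fm])
  have "integral\<^sup>N (Pi\<^sub>M ?I \<mu>) F \<le> integral\<^sup>N (Pi\<^sub>M ?I \<mu>) R"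
    unfolding F_def R_def using pint mm
    by (intro \<mu>.nn_integral_SUP_exp_symmetrization[where a="\<lambda>_. 0", unfolded add_0]) (auto simp: measurable_cong_sets[OF sets_\<mu> refl])
  then have le1: "(\<integral>\<^sup>+\<omega>. ?FZ \<omega> \<partial>M) \<le> (\<integral>\<^sup>+\<omega>. R (\<lambda>k\<in>?I. Z k \<omega>) \<partial>M)"
    unfolding law using Fm Rm Zv by (simp add: nn_integral_distr)
  have RN: "R (\<lambda>k\<in>?I. Z k \<omega>) \<le> ennreal ?e * ?N \<omega>" for \<omega>
  proof -
    have "R (\<lambda>k\<in>?I. Z k \<omega>) = (\<Sum>U\<in>Pow {1..n}. SUP g\<in>G0. ennreal (exp (2 * (\<Sum>k\<in>{1..n}. if k \<in> U
            then \<theta> * offset_excess \<sigma> \<gamma> (\<phi> k (X k \<omega>)) (trunc B (Y k \<omega>)) (g (X k \<omega>))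
            else \<theta> * offset_excess (- \<sigma>) 0 (\<phi> k (X k \<omega>)) (trunc B (Y k \<omega>)) (g (X k \<omega>)))))) / 2 ^ card {1..n}"
      unfolding R_def p_def m_def
      by (intro arg_cong2[where f="(/)"] sum.cong SUP_cong refl arg_cong[where f=ennreal] arg_cong[where f=exp]
          arg_cong2[where f="(+)"] arg_cong2[where f="(*)"]) (auto simp: Z_def)
    also have "\<dots> \<le> ennreal ?e * ?N \<omega>"
      using \<phi>b abs_trunc_le[OF B] par n G0 Gb B
      by (intro sum_signs_SUP_exp_le_covering_number[where w="\<lambda>k. \<phi> k (X k \<omega>)" and y="\<lambda>k. trunc B (Y k \<omega>)" and x="\<lambda>k. X k \<omega>"]) auto
    finally show ?thesis .
  qed
  have le2: "(\<integral>\<^sup>+\<omega>. ?FZ \<omega> \<partial>M) \<le> ennreal ?e * (\<integral>\<^sup>+\<omega>. ?N \<omega> \<partial>M)"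
  proof -
    \<comment> \<open>The covering number need not be measurable, so the factor is moved to the measurable side.\<close>
    have inv: "ennreal (1 / ?e) * (ennreal ?e * x) = x" for x
      by (simp add: mult.assoc[symmetric] flip: ennreal_mult')
    have "(\<integral>\<^sup>+\<omega>. R (\<lambda>k\<in>?I. Z k \<omega>) \<partial>M) = ennreal ?e * (\<integral>\<^sup>+\<omega>. ennreal (1 / ?e) * R (\<lambda>k\<in>?I. Z k \<omega>) \<partial>M)"
      using measurable_compose[OF Zv Rm]
      by (subst nn_integral_cmult) (simp_all add: mult.assoc[symmetric] flip: ennreal_mult')
    also have "\<dots> \<le> ennreal ?e * (\<integral>\<^sup>+\<omega>. ?N \<omega> \<partial>M)"
      using mult_left_mono[OF RN, of "ennreal (1 / ?e)"] unfolding inv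
      by (intro mult_left_mono nn_integral_mono) auto
    finally show ?thesis using le1 by simp
  qed
  have FZ_eq: "?FZ \<omega> = (SUP g\<in>G0. ennreal (exp (\<theta> * dev g \<omega>)))" for \<omega>
  proof -
    have "(\<integral>x. p g k x \<partial>\<mu> k) = \<theta> * expectation (\<lambda>\<omega>. offset_excess \<sigma> \<gamma> (\<phi> k (X k \<omega>)) (trunc B (Y k \<omega>)) (g (X k \<omega>)))"
      if "g \<in> G0" "k \<in> ?I" for g k
    proof -
      have "(\<integral>x. p g k x \<partial>\<mu> k) = expectation (\<lambda>\<omega>. p g k (Z k \<omega>))"
        using that pm[OF that] Z by (simp add: \<mu>_def integral_distr)
      then show ?thesis by (simp add: p_def Z_def)
    qed
    then show ?thesis
      unfolding F_def dev_def m_def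
      by (intro SUP_cong refl arg_cong[where f=ennreal] arg_cong[where f=exp])
        (auto simp: Z_def sum_distrib_left distrib_left intro!: sum.cong)
  qed
  show ev: "{\<omega> \<in> space M. \<exists>g\<in>G0. s < dev g \<omega>} \<in> events"
  proof -
    have "dev g \<in> borel_measurable M" if "g \<in> G0" for g
    proof -
      have "(\<lambda>\<omega>. offset_excess (- \<sigma>) 0 (\<phi> k (X k \<omega>)) (trunc B (Y k \<omega>)) (g (X k \<omega>))) \<in> borel_measurable M"
        if k: "k \<in> ?I" for k
      proof -
        have [measurable]: "g \<in> borel_measurable borel" "\<phi> k \<in> borel_measurable borel" using \<open>g \<in> G0\<close> k G0 Gm \<phi>m by auto
        have "(\<lambda>z. offset_excess (- \<sigma>) 0 (\<phi> k (fst z)) (trunc B (snd z)) (g (fst z))) \<in> borel_measurable (borel :: ('b \<times> real) measure)"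
          unfolding offset_excess_def by measurable
        from measurable_compose[OF Z[OF k] this] show ?thesis by (simp add: Z_def)
      qed
      then show ?thesis unfolding dev_def by measurable
    qed
    note [measurable] = this
    have "{\<omega> \<in> space M. \<exists>g\<in>G0. s < dev g \<omega>} = (\<Union>g\<in>G0. {\<omega> \<in> space M. s < dev g \<omega>})" by auto
    also have "\<dots> \<in> events" by (intro sets.countable_UN') auto
    finally show ?thesis .
  qed
  have "emeasure M {\<omega> \<in> space M. \<exists>g\<in>G0. s < dev g \<omega>} \<le> emeasure M {\<omega> \<in> space M. 1 \<le> ennreal (exp (- \<theta> * s)) * ?FZ \<omega>}"
  proof (rule emeasure_mono)
    show "{\<omega> \<in> space M. \<exists>g\<in>G0. s < dev g \<omega>} \<subseteq> {\<omega> \<in> space M. 1 \<le> ennreal (exp (- \<theta> * s)) * ?FZ \<omega>}"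
    proof safe
      fix \<omega> g assume g: "g \<in> G0" and s: "s < dev g \<omega>"
      have "1 \<le> exp (- \<theta> * s) * exp (\<theta> * dev g \<omega>)"
        using s par by (simp add: mult_left_mono flip: exp_add)
      then have "1 \<le> ennreal (exp (- \<theta> * s)) * ennreal (exp (\<theta> * dev g \<omega>))"
        by (simp flip: ennreal_mult' add: ennreal_ge_1)
      also have "\<dots> \<le> ennreal (exp (- \<theta> * s)) * ?FZ \<omega>"
        unfolding FZ_eq using g by (intro mult_left_mono SUP_upper) auto
      finally show "1 \<le> ennreal (exp (- \<theta> * s)) * ?FZ \<omega>" .
    qed
  qed measurable
  also have "\<dots> \<le> ennreal (exp (- \<theta> * s)) * (\<integral>\<^sup>+\<omega>. ?FZ \<omega> * indicator (space M) \<omega> \<partial>M)"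
    by (intro nn_integral_Markov_inequality borel_measurable_times_ennreal borel_measurable_indicator FZ sets.top)
  also have "(\<integral>\<^sup>+\<omega>. ?FZ \<omega> * indicator (space M) \<omega> \<partial>M) = (\<integral>\<^sup>+\<omega>. ?FZ \<omega> \<partial>M)"
    by (intro nn_integral_cong) auto
  also have "ennreal (exp (- \<theta> * s)) * \<dots> \<le> ennreal (exp (- \<theta> * s)) * (ennreal ?e * (\<integral>\<^sup>+\<omega>. ?N \<omega> \<partial>M))"
    by (intro mult_left_mono le2) auto
  also have "\<dots> = (ennreal (exp (- \<theta> * s)) * ennreal ?e) * (\<integral>\<^sup>+\<omega>. ?N \<omega> \<partial>M)"
    by (simp only: mult.assoc)
  also have "ennreal (exp (- \<theta> * s)) * ennreal ?e = ennreal (exp (16 * \<theta> * B * real n * r - \<theta> * s))"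
    by (subst ennreal_mult'[symmetric]) (simp_all flip: exp_add)
  finally show "emeasure M {\<omega> \<in> space M. \<exists>g\<in>G0. s < dev g \<omega>}
      \<le> ennreal (exp (16 * \<theta> * B * real n * r - \<theta> * s)) * (\<integral>\<^sup>+\<omega>. ?N \<omega> \<partial>M)" .
qed

section \<open>Excess risk and the constants of the bound\<close>

text \<open>
  The excess loss differs from \<open>(g - \<phi>)\<^sup>2\<close> by \<open>2 (g - \<phi>) (\<phi> - V)\<close>, which has mean zero because \<open>g - \<phi>\<close>
  is a function of \<open>X\<close> and \<open>\<phi>\<close> is the conditional mean of \<open>V\<close> given \<open>X\<close>.
\<close>

lemma (in prob_space) expectation_excess_eq_square_distance:
  fixes X :: "'a \<Rightarrow> 'b::topological_space"
  assumes X [measurable]: "X \<in> borel_measurable M" and V [measurable]: "V \<in> borel_measurable M"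
    and g [measurable]: "g \<in> borel_measurable borel" and \<phi> [measurable]: "\<phi> \<in> borel_measurable borel"
    and bd: "\<And>x. \<bar>g x\<bar> \<le> B" "\<And>x. \<bar>\<phi> x\<bar> \<le> B" "\<And>\<omega>. \<bar>V \<omega>\<bar> \<le> B"
    and cond: "AE \<omega> in M. \<phi> (X \<omega>) = real_cond_exp M (vimage_algebra (space M) X borel) V \<omega>"
  shows "expectation (\<lambda>\<omega>. (g (X \<omega>) - V \<omega>)\<^sup>2 - (\<phi> (X \<omega>) - V \<omega>)\<^sup>2) = expectation (\<lambda>\<omega>. (g (X \<omega>) - \<phi> (X \<omega>))\<^sup>2)"
proof -
  let ?F = "vimage_algebra (space M) X borel"
  have "subalgebra M ?F"
    unfolding subalgebra_def sets_vimage_algebra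
    by (auto intro!: sets.sigma_sets_subset)
  then interpret finite_measure_subalgebra M ?F
    by unfold_locales
  let ?D = "\<lambda>\<omega>. g (X \<omega>) - \<phi> (X \<omega>)"
  have [measurable]: "X \<in> measurable ?F borel" by (intro measurable_vimage_algebra1) auto
  have D: "?D \<in> borel_measurable ?F" by measurable
  have dB: "\<bar>?D \<omega>\<bar> \<le> 2 * B" for \<omega> using bd(1)[of "X \<omega>"] bd(2)[of "X \<omega>"] by linarith
  have B: "0 \<le> B" using bd(3) abs_ge_zero order_trans by blast
  have i1: "integrable M (\<lambda>\<omega>. ?D \<omega> * V \<omega>)"
    using dB bd B by (intro integrable_const_bound[where B="2 * B * B"] AE_I2) (auto simp: abs_mult intro!: mult_mono)
  have i2: "integrable M (\<lambda>\<omega>. ?D \<omega> * \<phi> (X \<omega>))"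
    using dB bd B by (intro integrable_const_bound[where B="2 * B * B"] AE_I2) (auto simp: abs_mult intro!: mult_mono)
  have i3: "integrable M (\<lambda>\<omega>. (?D \<omega>)\<^sup>2)"
    using power_mono[OF dB abs_ge_zero, where n=2] by (intro integrable_const_bound[where B="(2 * B)\<^sup>2"] AE_I2) auto
  have "expectation (\<lambda>\<omega>. ?D \<omega> * V \<omega>) = expectation (\<lambda>\<omega>. ?D \<omega> * real_cond_exp M ?F V \<omega>)"
    using real_cond_exp_intg(2)[OF i1 D V] by simp
  also have "\<dots> = expectation (\<lambda>\<omega>. ?D \<omega> * \<phi> (X \<omega>))"
    using cond by (intro integral_cong_AE) auto
  finally have eq: "expectation (\<lambda>\<omega>. ?D \<omega> * V \<omega>) = expectation (\<lambda>\<omega>. ?D \<omega> * \<phi> (X \<omega>))" .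
  have "expectation (\<lambda>\<omega>. (g (X \<omega>) - V \<omega>)\<^sup>2 - (\<phi> (X \<omega>) - V \<omega>)\<^sup>2)
      = expectation (\<lambda>\<omega>. (?D \<omega>)\<^sup>2 + 2 * (?D \<omega> * \<phi> (X \<omega>) - ?D \<omega> * V \<omega>))"
    by (intro Bochner_Integration.integral_cong) (auto simp: power2_eq_square algebra_simps)
  also have "\<dots> = expectation (\<lambda>\<omega>. (?D \<omega>)\<^sup>2)"
    using i1 i2 i3 eq by simp
  finally show ?thesis .
qed

lemma covering_number_ge_1:
  assumes "F \<noteq> {}" shows "1 \<le> covering_number F n x r"
proof (cases "covering_number F n x r = \<infinity>")
  case False
  obtain L0 where "L0 \<subseteq> {1..n} \<rightarrow>\<^sub>E borel_measurable borel"
    and L0: "finite L0" "covering_number F n x r = enat (card L0)"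
    and cover: "\<And>f. f \<in> F \<Longrightarrow> \<exists>l\<in>L0. 1 / real n * (\<Sum>k=1..n. \<bar>l k (x k) - f (x k)\<bar>) \<le> r"
    by (rule covering_number_attained[OF False]) (rule that)
  have "L0 \<noteq> {}" using assms cover by fastforce
  then have "1 \<le> card L0" using L0(1) by (simp add: Suc_le_eq card_gt_0_iff)
  then show ?thesis using L0(2) by (simp add: one_enat_def)
qed simp

lemma b_rate_pos:
  assumes "B > 0" "c > 1" "lam > 1"
  shows "b_rate B c lam > 0"
proof -
  define D where "D = 1 / 3 * (1 - 1 / c) * (1 - 1 / lam) + (2 * lam - 1)"
  have "0 \<le> 1 / 3 * (1 - 1 / c) * (1 - 1 / lam)" using assms by (intro mult_nonneg_nonneg) auto
  then have "D > 0" unfolding D_def using assms by linarith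
  then have "0 < 1 / D\<^sup>2" by simp
  moreover have "0 < 1 / (2 ^ 5 * B\<^sup>2)" "0 < (1 - 1 / c) ^ 3" "0 < 1 - 1 / lam" using assms by auto
  ultimately show ?thesis unfolding b_rate_def D_def[symmetric] power_one_over by (intro mult_pos_pos) (simp_all only:)
qed

lemma b_rate_le:
  assumes "B > 0" "c > 1" "lam > 1"
  shows "b_rate B c lam \<le> (lam - 1) / (32 * B\<^sup>2 * (2 * lam - 1)\<^sup>2)"
proof -
  let ?D = "1 / 3 * (1 - 1 / c) * (1 - 1 / lam) + (2 * lam - 1)"
  have "0 \<le> 1 / 3 * (1 - 1 / c) * (1 - 1 / lam)" using assms by (intro mult_nonneg_nonneg) auto
  then have "2 * lam - 1 \<le> ?D" "0 < ?D" "0 < 2 * lam - 1" using assms by linarith+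
  then have "1 / ?D\<^sup>2 \<le> 1 / (2 * lam - 1)\<^sup>2"
    by (intro divide_left_mono power_mono mult_pos_pos zero_less_power) simp_all
  moreover have "(1 - 1 / c) ^ 3 \<le> 1" using assms by (intro power_le_one) auto
  moreover have "1 - 1 / lam \<le> lam - 1" using assms by (simp add: field_simps) (sos)
  ultimately have "1 / (2 ^ 5 * B\<^sup>2) * (1 / ?D\<^sup>2) * (1 - 1 / c) ^ 3 * (1 - 1 / lam)
    \<le> 1 / (2 ^ 5 * B\<^sup>2) * (1 / (2 * lam - 1)\<^sup>2) * 1 * (lam - 1)"
    using assms by (intro mult_mono mult_nonneg_nonneg) auto
  then show ?thesis unfolding b_rate_def by simp
qed

text \<open>
  The exponent of the deviation bound for the choices of \<open>\<theta>\<close> and of the threshold made in the proof of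
  the oracle inequality.  The radius \<open>r\<close> is small enough for the covering error \<open>16 B r\<close> to use up at most
  a third of the threshold \<open>3t/(2\<lambda> - 1)\<close>; the rest exceeds what \<open>b\<close> requires.
\<close>

lemma exponent_le:
  assumes "B > 0" "c > 1" "lam > 1" and \<epsilon>: "\<epsilon> \<le> t" and t: "0 \<le> t"
  defines "r \<equiv> 1 / 2 ^ 5 * (1 / B) * (1 / (lam * (c - 1) + 1)) * (1 - 1 / c) * \<epsilon>"
    and "\<theta> \<equiv> (lam - 1) / (2 * lam - 1) / (16 * B\<^sup>2)"
  shows "16 * \<theta> * B * real n * r - \<theta> * (real n * (3 * t / (2 * lam - 1))) \<le> - (real n * b_rate B c lam * t)"
proof -
  have pos: "0 < lam * (c - 1) + 1" "0 < 2 * lam - 1" "0 \<le> \<theta>"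
    using assms by (auto simp: \<theta>_def intro!: add_pos_pos mult_pos_pos)
  have "(1 / (lam * (c - 1) + 1)) * (1 - 1 / c) \<le> 2 / (2 * lam - 1)"
  proof -
    have "(c - 1) * (2 * lam - 1) \<le> 2 * (c * (lam * (c - 1) + 1))"
    proof -
      have "lam * (c - 1) * 1 \<le> lam * (c - 1) * c" using assms by (intro mult_left_mono mult_nonneg_nonneg) auto
      then show ?thesis using assms by (simp add: algebra_simps)
    qed
    moreover have "(1 / (lam * (c - 1) + 1)) * (1 - 1 / c) = (c - 1) / (c * (lam * (c - 1) + 1))"
      using assms pos by (simp add: divide_simps)
    moreover have "x / K \<le> 2 / m" if "x * m \<le> 2 * K" "0 < K" "0 < m" for x K m :: real
      using that by (simp add: field_simps)
    ultimately show ?thesis using assms pos by simp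
  qed
  moreover have "0 \<le> (1 / (lam * (c - 1) + 1)) * (1 - 1 / c)" using assms pos by (intro mult_nonneg_nonneg) auto
  ultimately have "(1 / (lam * (c - 1) + 1)) * (1 - 1 / c) * \<epsilon> \<le> 2 / (2 * lam - 1) * t"
    using \<epsilon> t pos by (intro order_trans[OF mult_left_mono[OF \<epsilon>] mult_right_mono]) auto
  moreover have "16 * B * r = ((1 / (lam * (c - 1) + 1)) * (1 - 1 / c) * \<epsilon>) / 2"
  proof -
    have "16 * B * (1 / 2 ^ 5 * (1 / B) * x * y * \<epsilon>) = (x * y * \<epsilon>) / 2" for x y
      using assms(1) by simp
    then show ?thesis unfolding r_def .
  qed
  ultimately have "16 * B * r \<le> (2 / (2 * lam - 1) * t) / 2"
    by (metis divide_right_mono zero_le_numeral)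
  moreover have "(2 / m * t) / 2 = t / m" for m by simp
  ultimately have "16 * B * r \<le> t / (2 * lam - 1)" by (simp only:)
  then have "16 * B * r - 3 * t / (2 * lam - 1) \<le> - (2 * t / (2 * lam - 1))"
    by (simp add: field_simps)
  then have "\<theta> * real n * (16 * B * r - 3 * t / (2 * lam - 1)) \<le> \<theta> * real n * (- (2 * t / (2 * lam - 1)))"
    using pos by (intro mult_left_mono) auto
  moreover have "b_rate B c lam * t \<le> \<theta> * (2 * t / (2 * lam - 1))"
  proof -
    have "b_rate B c lam * t \<le> (lam - 1) / (32 * B\<^sup>2 * (2 * lam - 1)\<^sup>2) * t"
      using assms by (intro mult_right_mono b_rate_le) auto
    also have "\<dots> \<le> 4 * ((lam - 1) / (32 * B\<^sup>2 * (2 * lam - 1)\<^sup>2) * t)"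
    proof -
      have "0 \<le> (lam - 1) / (32 * B\<^sup>2 * (2 * lam - 1)\<^sup>2) * t" using assms(3) t by simp
      then show ?thesis by linarith
    qed
    also have "\<dots> = \<theta> * (2 * t / (2 * lam - 1))"
      using pos by (simp add: \<theta>_def power2_eq_square)
    finally show ?thesis .
  qed
  from mult_left_mono[OF this, of "real n"] have "real n * b_rate B c lam * t \<le> \<theta> * real n * (2 * t / (2 * lam - 1))"
    by (simp add: mult_ac)
  moreover have "3 * t / (2 * lam - 1) = 3 * (t / (2 * lam - 1))" "2 * t / (2 * lam - 1) = 2 * (t / (2 * lam - 1))"
    by simp_all
  moreover have "16 * \<theta> * B * real n * r - \<theta> * (real n * (3 * q)) \<le> - x"
    if "\<theta> * real n * (16 * B * r - 3 * q) \<le> \<theta> * real n * (- (2 * q))" "x \<le> \<theta> * real n * (2 * q)" for q x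
    using that by (simp add: algebra_simps)
  ultimately show ?thesis by (simp only:)
qed

section \<open>The oracle inequality\<close>

theorem theorem4p2:
  fixes M :: "'w measure"
    and X :: "nat \<Rightarrow> 'w \<Rightarrow> 'a::polish_space"
    and Y :: "nat \<Rightarrow> 'w \<Rightarrow> real"
    and B c lam \<delta> :: real
    and n :: nat
    and G :: "('a \<Rightarrow> real) set"
    and ghat :: "'w \<Rightarrow> 'a \<Rightarrow> real"
    and gtilde :: "'a \<Rightarrow> real"
    and \<phi> :: "nat \<Rightarrow> 'a \<Rightarrow> real"
  assumes "prob_space M"
    and "B > 0" and "n \<ge> 1"
    and "prob_space.indep_vars M (\<lambda>k. borel :: ('a \<times> real) measure) (\<lambda>k \<omega>. (X k \<omega>, Y k \<omega>)) {1..n}"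
    and "G \<noteq> {}" and "pointwise_measurable G"
    and "\<And>g. g \<in> G \<Longrightarrow> g \<in> borel_measurable borel"
    and "\<And>g x. g \<in> G \<Longrightarrow> \<bar>g x\<bar> \<le> B"
    and "\<And>\<omega>. \<omega> \<in> space M \<Longrightarrow>
           is_arg_min (\<lambda>g. \<Sum>k=1..n. \<bar>g (X k \<omega>) - trunc B (Y k \<omega>)\<bar>\<^sup>2) (\<lambda>g. g \<in> G) (ghat \<omega>)"
    and "is_arg_min (\<lambda>g. \<Sum>k=1..n. prob_space.expectation M (\<lambda>\<omega>. \<bar>g (X k \<omega>) - trunc B (Y k \<omega>)\<bar>\<^sup>2))
           (\<lambda>g. g \<in> G) gtilde"
    and "\<And>k. k \<in> {1..n} \<Longrightarrow> \<phi> k \<in> borel_measurable borel"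
    and "\<And>k x. k \<in> {1..n} \<Longrightarrow> \<phi> k x \<in> {-B..B}"
    and "\<And>k. k \<in> {1..n} \<Longrightarrow>
           AE \<omega> in M. \<phi> k (X k \<omega>) =
             real_cond_exp M (vimage_algebra (space M) (X k) borel) (\<lambda>\<omega>. trunc B (Y k \<omega>)) \<omega>"
    and "c > 1" and "lam > 1" and "0 < \<delta>" and "\<delta> < 1"
  shows "\<exists>E \<in> sets M. measure M E \<ge> 1 - \<delta> \<and>
    (\<forall>\<omega> \<in> E.
      ereal (1 / real n * (\<Sum>k=1..n. (L2_norm (distr M borel (X k)) (\<lambda>x. ghat \<omega> x - \<phi> k x))\<^sup>2))
      \<le> ereal ((6 * lam - 5) *
           (INF g\<in>G. 1 / real n * (\<Sum>k=1..n. (L2_norm (distr M borel (X k)) (\<lambda>x. g x - \<phi> k x))\<^sup>2)))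
        + 6 * max (ereal (eps_n B n c lam))
            (ereal (1 / (real n * b_rate B c lam)) *
               (log_ennreal (a_cov M X B G n c lam (eps_n B n c lam)) + ereal (ln (2 / \<delta>)))))"
proof -
  interpret prob_space M by fact
  note B = \<open>B > 0\<close> and n = \<open>n \<ge> 1\<close> and c = \<open>c > 1\<close> and lam = \<open>lam > 1\<close> and \<delta> = \<open>0 < \<delta>\<close> \<open>\<delta> < 1\<close>
  note Gm = assms(7) and Gb = assms(8) and \<phi>m = assms(11)
  have \<phi>b: "\<bar>\<phi> k x\<bar> \<le> B" if "k \<in> {1..n}" for k x using assms(12)[OF that, of x] by auto
  have XY: "(\<lambda>\<omega>. (X k \<omega>, Y k \<omega>)) \<in> M \<rightarrow>\<^sub>M borel" if "k \<in> {1..n}" for k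
    using assms(4) that unfolding indep_vars_def by auto
  have Xm [measurable]: "X k \<in> borel_measurable M" if "k \<in> {1..n}" for k
    using measurable_compose[OF XY[OF that] borel_measurable_continuous_onI[OF continuous_on_fst[OF continuous_on_id]]] by simp
  have Ym [measurable]: "Y k \<in> borel_measurable M" if "k \<in> {1..n}" for k
    using measurable_compose[OF XY[OF that] borel_measurable_continuous_onI[OF continuous_on_snd[OF continuous_on_id]]] by simp
  let ?T = "\<lambda>k \<omega>. trunc B (Y k \<omega>)"
  have Tb: "\<bar>?T k \<omega>\<bar> \<le> B" for k \<omega> using B by (intro abs_trunc_le) simp
  define d where "d g = (\<Sum>k=1..n. expectation (\<lambda>\<omega>. (g (X k \<omega>) - \<phi> k (X k \<omega>))\<^sup>2))" for g
  define e where "e g \<omega> = (\<Sum>k=1..n. (g (X k \<omega>) - ?T k \<omega>)\<^sup>2 - (\<phi> k (X k \<omega>) - ?T k \<omega>)\<^sup>2)" for g \<omega>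
  have L2: "1 / real n * (\<Sum>k=1..n. (L2_norm (distr M borel (X k)) (\<lambda>x. g x - \<phi> k x))\<^sup>2) = 1 / real n * d g"
    if "g \<in> G" for g
  proof -
    have [measurable]: "g \<in> borel_measurable borel" using Gm that .
    have "(L2_norm (distr M borel (X k)) (\<lambda>x. g x - \<phi> k x))\<^sup>2 = expectation (\<lambda>\<omega>. (g (X k \<omega>) - \<phi> k (X k \<omega>))\<^sup>2)"
      if k: "k \<in> {1..n}" for k
    proof -
      note [measurable] = \<phi>m[OF k] Xm[OF k]
      have "(LINT x|distr M borel (X k). \<bar>g x - \<phi> k x\<bar>\<^sup>2) = expectation (\<lambda>\<omega>. \<bar>g (X k \<omega>) - \<phi> k (X k \<omega>)\<bar>\<^sup>2)"
        by (subst integral_distr) auto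
      then show ?thesis unfolding L2_norm_def by (simp add: integral_nonneg_AE)
    qed
    then show ?thesis unfolding d_def by simp
  qed
  have int_sq: "integrable M (\<lambda>\<omega>. (f (X k \<omega>) - ?T k \<omega>)\<^sup>2)"
    if k: "k \<in> {1..n}" and [measurable]: "f \<in> borel_measurable borel" and f: "\<And>x. \<bar>f x\<bar> \<le> B" for f k
  proof -
    note [measurable] = Xm[OF k] Ym[OF k]
    have "\<bar>f (X k \<omega>) - ?T k \<omega>\<bar> \<le> 2 * B" for \<omega> using f[of "X k \<omega>"] Tb[of k \<omega>] by linarith
    from power_mono[OF this abs_ge_zero, where n=2] show ?thesis
      by (intro integrable_const_bound[where B="(2 * B)\<^sup>2"] AE_I2) auto
  qed
  have exc: "expectation (\<lambda>\<omega>. (g (X k \<omega>) - ?T k \<omega>)\<^sup>2 - (\<phi> k (X k \<omega>) - ?T k \<omega>)\<^sup>2)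
      = expectation (\<lambda>\<omega>. (g (X k \<omega>) - \<phi> k (X k \<omega>))\<^sup>2)" if "g \<in> G" "k \<in> {1..n}" for g k
    using that Xm Ym Gm Gb \<phi>m \<phi>b Tb assms(13)
    by (intro expectation_excess_eq_square_distance[where B=B]) auto
  have int_d: "integrable M (\<lambda>\<omega>. (g (X k \<omega>) - \<phi> k (X k \<omega>))\<^sup>2)" if g: "g \<in> G" and k: "k \<in> {1..n}" for g k
  proof -
    note [measurable] = Xm[OF k] \<phi>m[OF k] Gm[OF g]
    have "\<bar>g (X k \<omega>) - \<phi> k (X k \<omega>)\<bar> \<le> 2 * B" for \<omega> using Gb[OF g, of "X k \<omega>"] \<phi>b[OF k, of "X k \<omega>"] by linarith
    from power_mono[OF this abs_ge_zero, where n=2] show ?thesis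
      by (intro integrable_const_bound[where B="(2 * B)\<^sup>2"] AE_I2) auto
  qed
  \<comment> \<open>The risk of \<open>g\<close> is \<open>d g\<close> plus a constant, so \<open>gtilde\<close> also minimizes \<open>d\<close>.\<close>
  have d_risk: "(\<Sum>k=1..n. expectation (\<lambda>\<omega>. \<bar>g (X k \<omega>) - ?T k \<omega>\<bar>\<^sup>2)) = d g + (\<Sum>k=1..n. expectation (\<lambda>\<omega>. (\<phi> k (X k \<omega>) - ?T k \<omega>)\<^sup>2))"
    if g: "g \<in> G" for g
  proof -
    have "expectation (\<lambda>\<omega>. \<bar>g (X k \<omega>) - ?T k \<omega>\<bar>\<^sup>2) = expectation (\<lambda>\<omega>. (g (X k \<omega>) - \<phi> k (X k \<omega>))\<^sup>2)
       + expectation (\<lambda>\<omega>. (\<phi> k (X k \<omega>) - ?T k \<omega>)\<^sup>2)" if k: "k \<in> {1..n}" for k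
      using exc[OF g k] int_sq[OF k Gm[OF g]] Gb[OF g] int_sq[OF k \<phi>m[OF k]] \<phi>b[OF k] by simp
    then show ?thesis unfolding d_def by (simp add: sum.distrib)
  qed
  have gt: "gtilde \<in> G" using assms(10) unfolding is_arg_min_def by blast
  have gt_min: "d gtilde \<le> d g" if "g \<in> G" for g
    using assms(10) that d_risk[OF gt] d_risk[OF that] unfolding is_arg_min_def by (auto simp: not_less)
  have gh: "ghat \<omega> \<in> G" and gh_min: "e (ghat \<omega>) \<omega> \<le> e gtilde \<omega>" if "\<omega> \<in> space M" for \<omega>
    using assms(9)[OF that] gt unfolding is_arg_min_def e_def by (auto simp: not_less sum_subtractf)
  obtain G0 where G0: "G0 \<subseteq> G" "countable G0"
    and dense: "\<And>g. g \<in> G \<Longrightarrow> \<exists>h :: nat \<Rightarrow> 'a \<Rightarrow> real. (\<forall>i. h i \<in> G0) \<and> (\<forall>x. (\<lambda>i. h i x) \<longlonglongrightarrow> g x)"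
    using assms(6) unfolding pointwise_measurable_def by blast
  \<comment> \<open>Inequalities pass from the countable subfamily to all of \<open>G\<close>, in particular to \<open>ghat \<omega>\<close>, by dominated convergence.\<close>
  have extend: "\<alpha> * d g + \<beta> * e g \<omega> \<le> s" if le: "\<And>h. h \<in> G0 \<Longrightarrow> \<alpha> * d h + \<beta> * e h \<omega> \<le> s" and g: "g \<in> G" for \<alpha> \<beta> \<omega> s g
  proof -
    obtain h :: "nat \<Rightarrow> 'a \<Rightarrow> real" where h: "\<And>i. h i \<in> G0" and lim: "\<And>x. (\<lambda>i. h i x) \<longlonglongrightarrow> g x"
      using dense[OF g] by blast
    have hG: "h i \<in> G" for i using h G0 by auto
    have "(\<lambda>i. d (h i)) \<longlonglongrightarrow> d g"
      unfolding d_def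
    proof (intro tendsto_sum)
      fix k assume k: "k \<in> {1..n}"
      have bd: "\<bar>h i (X k \<omega>) - \<phi> k (X k \<omega>)\<bar> \<le> 2 * B" for i \<omega>
        using Gb[OF hG, of i "X k \<omega>"] \<phi>b[OF k, of "X k \<omega>"] by linarith
      show "(\<lambda>i. expectation (\<lambda>\<omega>. (h i (X k \<omega>) - \<phi> k (X k \<omega>))\<^sup>2)) \<longlonglongrightarrow> expectation (\<lambda>\<omega>. (g (X k \<omega>) - \<phi> k (X k \<omega>))\<^sup>2)"
        using int_d[OF g k] int_d[OF hG k] power_mono[OF bd abs_ge_zero, where n=2]
        by (intro integral_dominated_convergence[where w="\<lambda>_. (2 * B)\<^sup>2"] AE_I2 tendsto_intros lim) auto
    qed
    moreover have "(\<lambda>i. e (h i) \<omega>) \<longlonglongrightarrow> e g \<omega>"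
      unfolding e_def by (intro tendsto_intros lim)
    ultimately have "(\<lambda>i. \<alpha> * d (h i) + \<beta> * e (h i) \<omega>) \<longlonglongrightarrow> \<alpha> * d g + \<beta> * e g \<omega>"
      by (intro tendsto_intros)
    then show ?thesis by (rule LIMSEQ_le_const2) (use le h in auto)
  qed
  define \<epsilon> where "\<epsilon> = eps_n B n c lam"
  define b where "b = b_rate B c lam"
  define a where "a = a_cov M X B G n c lam \<epsilon>"
  define r where "r = 1 / 2 ^ 5 * (1 / B) * (1 / (lam * (c - 1) + 1)) * (1 - 1 / c) * \<epsilon>"
  let ?N = "\<lambda>\<omega>. ennreal_of_enat (covering_number (trunc_family B G) n (\<lambda>k. X k \<omega>) r)"
  have b: "b > 0" unfolding b_def using B c lam by (rule b_rate_pos)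
  have N_le_A: "?N \<omega> \<le> A_cov B G n (\<lambda>k. X k \<omega>) c lam \<epsilon>" for \<omega>
  proof -
    have "1 * 1 \<le> (2 * (c + 1)) * (2 * c + 3)" using c by (intro mult_mono) auto
    then have "1 \<le> ennreal (2 * (c + 1) * (2 * c + 3))" by (simp add: ennreal_ge_1)
    from mult_right_mono[OF this, of "?N \<omega>"] show ?thesis
      unfolding A_cov_def r_def by simp
  qed
  then have N_le_a: "(\<integral>\<^sup>+\<omega>. ?N \<omega> \<partial>M) \<le> a"
    unfolding a_def a_cov_def by (intro nn_integral_mono)
  have "1 \<le> a"
  proof -
    have "trunc_family B G \<noteq> {}" using assms(5) by (simp add: trunc_family_def)
    then have "1 \<le> ?N \<omega>" for \<omega>
      using covering_number_ge_1[of "trunc_family B G" n "\<lambda>k. X k \<omega>" r]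
      by (metis ennreal_of_enat_1 ennreal_of_enat_le_iff)
    then have "(\<integral>\<^sup>+\<omega>. 1 \<partial>M) \<le> (\<integral>\<^sup>+\<omega>. ?N \<omega> \<partial>M)" by (intro nn_integral_mono)
    then show ?thesis using N_le_a by (simp add: emeasure_space_1)
  qed
  have INF: "(INF g\<in>G. 1 / real n * (\<Sum>k=1..n. (L2_norm (distr M borel (X k)) (\<lambda>x. g x - \<phi> k x))\<^sup>2)) = 1 / real n * d gtilde"
  proof -
    have "(INF g\<in>G. 1 / real n * (\<Sum>k=1..n. (L2_norm (distr M borel (X k)) (\<lambda>x. g x - \<phi> k x))\<^sup>2)) = (INF g\<in>G. 1 / real n * d g)"
      by (intro INF_cong refl L2)
    also have "\<dots> = 1 / real n * d gtilde"
      using gt gt_min by (intro cInf_eq_minimum) (auto intro!: divide_right_mono)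
    finally show ?thesis .
  qed
  show ?thesis
  proof (cases "a = \<infinity>")
    case True
    have "ereal (1 / (real n * b)) * (log_ennreal a + ereal (ln (2 / \<delta>))) = \<infinity>"
      using True n b by (simp add: log_ennreal_def)
    then show ?thesis
      unfolding \<epsilon>_def[symmetric] b_def[symmetric] a_def[symmetric]
      by (intro bexI[of _ "space M"]) (use \<delta> in \<open>auto simp: prob_space\<close>)
  next
    case False
    then obtain \<alpha> where \<alpha>: "a = ennreal \<alpha>" "1 \<le> \<alpha>"
      using \<open>1 \<le> a\<close> by (cases a) (auto simp: ennreal_ge_1)
    define t where "t = max \<epsilon> (1 / (real n * b) * (ln \<alpha> + ln (2 / \<delta>)))"
    have rhs: "max (ereal \<epsilon>) (ereal (1 / (real n * b)) * (log_ennreal a + ereal (ln (2 / \<delta>)))) = ereal t"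
      using \<alpha> unfolding t_def log_ennreal_def by (simp add: max_def)
    have "1 / (real n * b) * (ln \<alpha> + ln (2 / \<delta>)) \<le> t" by (simp add: t_def)
    then have nbt: "ln \<alpha> + ln (2 / \<delta>) \<le> real n * b * t"
      using n b by (simp add: field_simps)
    have "0 \<le> ln \<alpha> + ln (2 / \<delta>)" using \<alpha> \<delta> by (intro add_nonneg_nonneg) (auto simp: ln_ge_zero_iff)
    then have t: "0 \<le> t" "\<epsilon> \<le> t" using n b unfolding t_def
      by (auto intro!: max.coboundedI2 mult_nonneg_nonneg divide_nonneg_pos mult_pos_pos)
    \<comment> \<open>\<open>\<gamma>\<close> is chosen such that \<open>1 - 2\<gamma> = 1/(2\<lambda> - 1)\<close>, and \<open>\<theta>\<close> is the largest value allowed by \<open>16 B\<^sup>2 \<theta> \<le> \<gamma>\<close>.\<close>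
    define \<gamma> where "\<gamma> = (lam - 1) / (2 * lam - 1)"
    define \<theta> where "\<theta> = \<gamma> / (16 * B\<^sup>2)"
    define s where "s = real n * (3 * t / (2 * lam - 1))"
    have \<gamma>: "0 \<le> \<gamma>" "\<gamma> \<le> 1/2" using lam by (auto simp: \<gamma>_def field_simps)
    have \<theta>: "0 \<le> \<theta>" "16 * B\<^sup>2 * \<theta> \<le> \<gamma>" using \<gamma> B by (auto simp: \<theta>_def)
    \<comment> \<open>As \<open>\<epsilon> \<le> t\<close>, the radius belonging to \<open>\<epsilon>\<close> is also small enough at level \<open>t\<close>.\<close>
    have tail: "ennreal (exp (16 * \<theta> * B * real n * r - \<theta> * s)) * (\<integral>\<^sup>+\<omega>. ?N \<omega> \<partial>M) \<le> ennreal (\<delta> / 2)"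
    proof -
      have "16 * \<theta> * B * real n * r - \<theta> * s \<le> - (real n * b * t)"
        using exponent_le[OF B c lam t(2,1), of n] unfolding \<theta>_def \<gamma>_def s_def r_def b_def .
      also have "\<dots> \<le> - (ln \<alpha> + ln (2 / \<delta>))" using nbt by simp
      finally have "exp (16 * \<theta> * B * real n * r - \<theta> * s) \<le> exp (- (ln \<alpha> + ln (2 / \<delta>)))" by simp
      also have "\<dots> = \<delta> / (2 * \<alpha>)" using \<alpha> \<delta> by (simp add: exp_minus exp_add exp_diff field_simps)
      finally have "ennreal (exp (16 * \<theta> * B * real n * r - \<theta> * s)) * (\<integral>\<^sup>+\<omega>. ?N \<omega> \<partial>M) \<le> ennreal (\<delta> / (2 * \<alpha>)) * a"
        by (intro mult_mono ennreal_leI N_le_a) auto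
      also have "\<dots> = ennreal (\<delta> / 2)" using \<alpha> \<delta> by (simp flip: ennreal_mult')
      finally show ?thesis .
    qed
    \<comment> \<open>The sign \<open>\<sigma> = 1\<close> gives the event that some \<open>\<Sum> f\<close> is too small, \<open>\<sigma> = -1\<close> that some \<open>\<Sum> f\<close> is too large.\<close>
    define bad where "bad \<sigma> = {\<omega> \<in> space M. \<exists>g\<in>G0. s < (\<sigma> - 2 * \<gamma>) * d g + (- \<sigma>) * e g \<omega>}" for \<sigma> :: real
    have bad: "bad \<sigma> \<in> events" "prob (bad \<sigma>) \<le> \<delta> / 2" if \<sigma>: "\<bar>\<sigma>\<bar> \<le> 1" for \<sigma>
    proof -
      have dev: "(\<Sum>k\<in>{1..n}. expectation (\<lambda>\<omega>. offset_excess \<sigma> \<gamma> (\<phi> k (X k \<omega>)) (?T k \<omega>) (g (X k \<omega>)))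
             + offset_excess (- \<sigma>) 0 (\<phi> k (X k \<omega>)) (?T k \<omega>) (g (X k \<omega>))) = (\<sigma> - 2 * \<gamma>) * d g + (- \<sigma>) * e g \<omega>"
        if g: "g \<in> G0" for g \<omega>
      proof -
        have gG: "g \<in> G" using g G0 by auto
        have "expectation (\<lambda>\<omega>. offset_excess \<sigma> \<gamma> (\<phi> k (X k \<omega>)) (?T k \<omega>) (g (X k \<omega>)))
          = (\<sigma> - 2 * \<gamma>) * expectation (\<lambda>\<omega>. (g (X k \<omega>) - \<phi> k (X k \<omega>))\<^sup>2)" if k: "k \<in> {1..n}" for k
        proof -
          have "integrable M (\<lambda>\<omega>. (g (X k \<omega>) - ?T k \<omega>)\<^sup>2 - (\<phi> k (X k \<omega>) - ?T k \<omega>)\<^sup>2)"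
            using int_sq[OF k Gm[OF gG] Gb[OF gG]] int_sq[OF k \<phi>m[OF k] \<phi>b[OF k]] by (rule Bochner_Integration.integrable_diff)
          then show ?thesis
            unfolding offset_excess_def using int_d[OF gG k] exc[OF gG k]
            by (simp add: left_diff_distrib)
        qed
        note mean = this
        show ?thesis
          unfolding d_def e_def sum_distrib_left sum.distrib[symmetric]
          by (intro sum.cong refl arg_cong2[where f="(+)"] mean) (auto simp: offset_excess_def)
      qed
      have bad_eq: "bad \<sigma> = {\<omega> \<in> space M. \<exists>g\<in>G0. s < (\<Sum>k\<in>{1..n}. expectation (\<lambda>\<omega>. offset_excess \<sigma> \<gamma> (\<phi> k (X k \<omega>)) (?T k \<omega>) (g (X k \<omega>)))
             + offset_excess (- \<sigma>) 0 (\<phi> k (X k \<omega>)) (?T k \<omega>) (g (X k \<omega>)))}"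
        unfolding bad_def by (intro Collect_cong conj_cong bex_cong refl) (simp only: dev)
      note dev_bound = uniform_offset_deviation[where X=X and Y=Y and n=n and B=B and G=G and \<phi>=\<phi> and s=s and \<sigma>=\<sigma> and \<gamma>=\<gamma> and \<theta>=\<theta>,
          OF assms(4) n less_imp_le[OF B] G0]
      show "bad \<sigma> \<in> events" unfolding bad_eq by (rule dev_bound(1)) (fact Gm Gb \<phi>m \<phi>b \<sigma> \<gamma> \<theta>)+
      have "emeasure M (bad \<sigma>) \<le> ennreal (\<delta> / 2)"
        unfolding bad_eq by (rule order_trans[OF dev_bound(2) tail]) (fact Gm Gb \<phi>m \<phi>b \<sigma> \<gamma> \<theta>)+
      then show "prob (bad \<sigma>) \<le> \<delta> / 2" using \<delta> by (simp add: emeasure_eq_measure)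
    qed
    have m1: "\<bar>1::real\<bar> \<le> 1" "\<bar>- 1::real\<bar> \<le> 1" by auto
    let ?E = "space M - (bad 1 \<union> bad (- 1))"
    have E: "?E \<in> events" using bad(1)[OF m1(1)] bad(1)[OF m1(2)] by auto
    have "prob (bad 1 \<union> bad (- 1)) \<le> \<delta>"
      using measure_Un_le[OF bad(1)[OF m1(1)] bad(1)[OF m1(2)]] bad(2)[OF m1(1)] bad(2)[OF m1(2)] by linarith
    then have PE: "1 - \<delta> \<le> prob ?E"
      using bad(1)[OF m1(1)] bad(1)[OF m1(2)] by (subst prob_compl) auto
    have main: "1 / real n * d (ghat \<omega>) \<le> (6 * lam - 5) * (1 / real n * d gtilde) + 6 * t" if \<omega>: "\<omega> \<in> ?E" for \<omega>
    proof -
      have \<omega>M: "\<omega> \<in> space M" using \<omega> by simp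
      have "\<And>g. g \<in> G0 \<Longrightarrow> (1 - 2 * \<gamma>) * d g + (- 1) * e g \<omega> \<le> s" "\<And>g. g \<in> G0 \<Longrightarrow> (- 1 - 2 * \<gamma>) * d g + 1 * e g \<omega> \<le> s"
        using \<omega> unfolding bad_def by (auto simp: not_less)
      from extend[OF this(1) gh[OF \<omega>M]] extend[OF this(2) gt] gh_min[OF \<omega>M]
      have "(1 - 2 * \<gamma>) * d (ghat \<omega>) \<le> (1 + 2 * \<gamma>) * d gtilde + 2 * s"
        by (auto simp: algebra_simps)
      moreover have "1 - 2 * \<gamma> = 1 / (2 * lam - 1)" "1 + 2 * \<gamma> = (4 * lam - 3) / (2 * lam - 1)"
        using lam by (auto simp: \<gamma>_def field_simps)
      ultimately have "d (ghat \<omega>) / (2 * lam - 1) \<le> ((4 * lam - 3) * d gtilde + 6 * real n * t) / (2 * lam - 1)"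
        by (simp add: s_def add_divide_distrib)
      then have "d (ghat \<omega>) \<le> (4 * lam - 3) * d gtilde + 6 * real n * t"
        using lam by (simp add: divide_le_cancel)
      also have "(4 * lam - 3) * d gtilde \<le> (6 * lam - 5) * d gtilde"
        using lam by (intro mult_right_mono) (auto simp: d_def intro!: sum_nonneg)
      finally show ?thesis using n by (simp add: field_simps)
    qed
    show ?thesis
      unfolding \<epsilon>_def[symmetric] b_def[symmetric] a_def[symmetric] rhs INF
    proof (intro bexI[OF _ E] conjI PE ballI)
      fix \<omega> assume \<omega>: "\<omega> \<in> ?E"
      then have \<omega>M: "\<omega> \<in> space M" by simp
      show "ereal (1 / real n * (\<Sum>k=1..n. (L2_norm (distr M borel (X k)) (\<lambda>x. ghat \<omega> x - \<phi> k x))\<^sup>2))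
          \<le> ereal ((6 * lam - 5) * (1 / real n * d gtilde)) + 6 * ereal t"
        unfolding L2[OF gh[OF \<omega>M]] using main[OF \<omega>] by simp
    qed
  qed
qed

end
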